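(* Let $f,g,h,R$ satisfy the data assumption stated in the context, and suppose that the optimal value function $v^*$ is radially unbounded, i.e. $\lim_{\|x\|\to\infty}v^*(x)=\infty$. Let $(u_0,\mathbb{R}^N)$ be an admissible controller--domain pair with $u_0\in C^\infty(\mathbb{R}^N,\mathbb{R}^M)$. Let $\{v_s\}$, $\{u_s\}$ be the sequences produced by the policy iteration on $\mathbb{R}^N$ described in the context. Then: 1. For every $s\in\mathbb{N}_0$ and all $x\in\mathbb{R}^N$, $\;v^*(x)\le v_{s+1}(x)\le v_s(x)$. 2. Suppose that for every compact $K\subset\mathbb{R}^N$ there exist constants $C_{\nabla v,K}>0$ and $C_{H_v,K}>0$ such that $$\max_{x\in K}\|\nabla v_s(x)\|\le C_{\nabla v,K}\quad\text{and}\quad\max_{x\in K}\|H_{v_s}(x)\|_2\le C_{H_v,K}\qquad\text{for all }s\in\mathbb{N}_0,$$ where $H_{v_s}$ is the Hessian of $v_s$. If, in addition, an optimal controller $u^*$ exists on $\mathbb{R}^N$, then: (i) $v^*\in C^1(\mathbb{R}^N,\mathbb{R})$ and $\lim_{s\to\infty}\|v_s-v^*\|_{C^1(K,\mathbb{R})}=0$ for every compact $K\subset\mathbb{R}^N$; (ii) $\lim_{s\to\infty}\|u_s-u^*\|_{C^0(K,\mathbb{R}^M)}=0$ for every compact $K\subset\mathbb{R}^N$.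
   Context: A domain is a non-empty, open and connected subset of $\mathbb{R}^N$; $\|\cdot\|$ is the Euclidean norm, $\|\cdot\|_2$ the spectral norm; $B_\varepsilon(0)$ is the open ball of radius $\varepsilon$ about $0$. $\|\cdot\|_{C^0(K)}$ is the sup norm on $K$ and $\|\cdot\|_{C^1(K)}$ is the norm of uniform convergence on $K$ of the function and its first-order derivatives. Data assumption: $f\in C^\infty(\mathbb{R}^N,\mathbb{R}^N)$, $g\in C^\infty(\mathbb{R}^N,\mathbb{R}^{N\times M})$, $h\in C^\infty(\mathbb{R}^N,\mathbb{R})$, $R\in\mathbb{R}^{M\times M}$ is symmetric positive-definite, $f(0)=0$, and $h$ is a positive-definite function, i.e. $h(0)=0$ and $h(x)>0$ for $x\ne0$. Optimal value function: with $\mathcal{U}_\infty$ the set of measurable essentially bounded $\mathbf{u}:[0,\infty)\to\mathbb{R}^M$, $$v^*(x)=\inf_{\mathbf{u}\in\mathcal{U}_\infty}\int_0^\infty\bigl[h(\mathbf{x}(t))+\langle\mathbf{u}(t),R\,\mathbf{u}(t)\rangle\bigr]\mathrm{d}t\quad\text{s.t.}\quad\dot{\mathbf{x}}(t)=f(\mathbf{x}(t))+g(\mathbf{x}(t))\mathbf{u}(t)\ \text{on }[0,\infty),\ \mathbf{x}(0)=x$$ (solutions in the Carathéodory sense). For a feedback controller $u:\Omega\to\mathbb{R}^M$, $\mathbf{x}_u(t;x)$ denotes the solution of the closed-loop system $\dot{\mathbf{x}}_u(t;x)=f(\mathbf{x}_u(t;x))+g(\mathbf{x}_u(t;x))u(\mathbf{x}_u(t;x))$,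 $\mathbf{x}_u(0;x)=x$. Optimal controller $u^*$ on $\mathbb{R}^N$: a continuous feedback $u^*:\mathbb{R}^N\to\mathbb{R}^M$ whose closed-loop trajectories exist for all $t\ge0$ and attain the infimum, i.e. $\int_0^\infty[h(\mathbf{x}_{u^*}(t;x))+\langle u^*(\mathbf{x}_{u^*}(t;x)),R\,u^*(\mathbf{x}_{u^*}(t;x))\rangle]\mathrm{d}t=v^*(x)$ for every $x\in\mathbb{R}^N$. Admissible controller--domain pair: for a domain $\Omega\subset\mathbb{R}^N$ and $u\in C^0(\Omega,\mathbb{R}^M)$, the pair $(u,\Omega)$ is admissible if (1) $0\in\Omega$; (2) $u(0)=0$; (3) for every $x\in\Omega$, $\mathbf{x}_u(t;x)\in\Omega$ for all $t\ge0$; (4) $\lim_{t\to\infty}\|\mathbf{x}_u(t;x)\|=0$ for all $x\in\Omega$; (5) there exist constants $\varepsilon,C,\nu>0$ with $B_\varepsilon(0)\subset\Omega$ such that $\|\mathbf{x}_u(t;x)\|\le Ce^{-\nu t}\|x\|$ for all $x\in B_\varepsilon(0)$ and $t\ge0$. Policy iteration on $\mathbb{R}^N$ (considered for all $s\in\mathbb{N}_0$, i.e. disregarding the stopping tolerance). Starting from $u_0$, for $s=0,1,2,\dots$: let $v_s\in C^1(\mathbb{R}^N,\mathbb{R})$ be the solution of $$\langle f(x)+g(x)u_s(x),\nabla v_s(x)\rangle+h(x)+\langle u_s(x),R\,u_s(x)\rangle=0\ \text{ for all }x\in\mathbb{R}^N,\qquad v_s(0)=0,$$ and set $u_{s+1}(x):=-\tfrac12R^{-1}g(x)^\top\nabla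 v_s(x)$. *)

theory Defs
  imports "HOL-Analysis.Analysis"
begin

section \<open>Smoothness, gradient, Hessian\<close>

text \<open>
  \<open>C_diff k w\<close>: \<open>w\<close> is of class $C^k$ on the whole space, i.e. all iterated directional
  derivatives up to order \<open>k\<close> exist and are continuous (for \<open>k > 0\<close> the continuity of lower-order
  derivatives follows from differentiability).
\<close>

primrec C_diff :: "nat \<Rightarrow> ('a::euclidean_space \<Rightarrow> 'b::real_normed_vector) \<Rightarrow> bool" where
  "C_diff 0 w \<longleftrightarrow> continuous_on UNIV w"
| "C_diff (Suc k) w \<longleftrightarrow>
     (\<forall>x. w differentiable (at x)) \<and> (\<forall>e. C_diff k (\<lambda>x. frechet_derivative w (at x) e))"

definition C_infinity :: "('a::euclidean_space \<Rightarrow> 'b::real_normed_vector) \<Rightarrow> bool" where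
  "C_infinity w \<longleftrightarrow> (\<forall>k. C_diff k w)"

definition grad :: "(real^'n \<Rightarrow> real) \<Rightarrow> real^'n \<Rightarrow> real^'n" where
  "grad w x = (THE d. GDERIV w x :> d)"

lemma grad_eqI: "GDERIV w x :> d \<Longrightarrow> grad w x = d"
  unfolding grad_def gderiv_def
  by (rule the_equality, assumption)
     (metis has_derivative_unique inner_commute vector_eq_ldot)

lemma grad_works: "w differentiable (at x) \<Longrightarrow> GDERIV w x :> grad w x"
proof -
  assume "w differentiable (at x)"
  then obtain D where D: "(w has_derivative D) (at x)"
    unfolding differentiable_def by blast
  then have "D = (\<lambda>y. inner y (adjoint D 1))"
    using adjoint_works[OF has_derivative_linear[OF D], of _ 1] by auto
  with D have "GDERIV w x :> adjoint D 1"
    unfolding gderiv_def by simp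
  then show ?thesis
    using grad_eqI by metis
qed

text \<open>A relation, in the manner of \<open>has_derivative\<close>: it asserts that the Hessian exists at \<open>x\<close>.\<close>

definition has_hessian :: "(real^'n \<Rightarrow> real) \<Rightarrow> real^'n^'n \<Rightarrow> real^'n \<Rightarrow> bool" where
  "has_hessian w H x \<longleftrightarrow> (grad w has_derivative (\<lambda>y. H *v y)) (at x)"

definition spectral_norm :: "real^'n^'m \<Rightarrow> real" where
  "spectral_norm A = onorm ((*v) A)"

text \<open>The norms of \<open>C\<^sup>0(K)\<close> and \<open>C\<^sup>1(K)\<close>; the supremum over the empty set has to be fixed to 0
  by hand, since \<open>Sup {}\<close> is unspecified on the reals.\<close>

definition C0_norm :: "'a set \<Rightarrow> ('a \<Rightarrow> 'b::real_normed_vector) \<Rightarrow> real" where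
  "C0_norm K w = (if K = {} then 0 else (SUP x\<in>K. norm (w x)))"

definition C1_norm :: "(real^'n) set \<Rightarrow> (real^'n \<Rightarrow> real) \<Rightarrow> real" where
  "C1_norm K w = C0_norm K w + C0_norm K (grad w)"


section \<open>The optimal control problem\<close>

definition data_assumption ::
  "(real^'n \<Rightarrow> real^'n) \<Rightarrow> (real^'n \<Rightarrow> real^'m^'n) \<Rightarrow> (real^'n \<Rightarrow> real) \<Rightarrow> real^'m^'m \<Rightarrow> bool" where
  "data_assumption f g h R \<longleftrightarrow>
     C_infinity f \<and> C_infinity g \<and> C_infinity h \<and>
     transpose R = R \<and> (\<forall>z. z \<noteq> 0 \<longrightarrow> z \<bullet> (R *v z) > 0) \<and>
     f 0 = 0 \<and> h 0 = 0 \<and> (\<forall>x. x \<noteq> 0 \<longrightarrow> h x > 0)"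

text \<open>Functions of time are functions on \<^typ>\<open>real\<close>, of which only the values on \<open>[0,\<infinity>)\<close> matter.\<close>

definition controls :: "(real \<Rightarrow> real^'m) set" where
  "controls = {c. c \<in> borel_measurable (lebesgue_on {0..}) \<and>
                  (\<exists>B. AE t in lebesgue_on {0..}. norm (c t) \<le> B)}"

text \<open>Caratheodory solution on \<open>[0,\<infinity>)\<close>: \<open>y\<close> is the integral of the right-hand side, which is locally
  Lebesgue integrable. In particular \<open>y\<close> is locally absolutely continuous.\<close>

definition caratheodory_solution ::
  "(real^'n \<Rightarrow> real^'n) \<Rightarrow> (real^'n \<Rightarrow> real^'m^'n) \<Rightarrow> (real \<Rightarrow> real^'m) \<Rightarrow> real^'n \<Rightarrow> (real \<Rightarrow> real^'n) \<Rightarrow> bool"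
  where
  "caratheodory_solution f g c x y \<longleftrightarrow>
     (\<forall>t\<ge>0. (\<lambda>\<tau>. f (y \<tau>) + g (y \<tau>) *v c \<tau>) absolutely_integrable_on {0..t} \<and>
            y t = x + integral {0..t} (\<lambda>\<tau>. f (y \<tau>) + g (y \<tau>) *v c \<tau>))"

text \<open>The integrand is nonnegative under the data assumption; the value \<open>\<infinity>\<close> is allowed.\<close>

definition cost ::
  "(real^'n \<Rightarrow> real) \<Rightarrow> real^'m^'m \<Rightarrow> (real \<Rightarrow> real^'n) \<Rightarrow> (real \<Rightarrow> real^'m) \<Rightarrow> ereal" where
  "cost h R y c =
     enn2ereal (\<integral>\<^sup>+ t. ennreal (h (y t) + c t \<bullet> (R *v c t)) \<partial>lebesgue_on {0..})"

definition optimal_value ::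
  "(real^'n \<Rightarrow> real^'n) \<Rightarrow> (real^'n \<Rightarrow> real^'m^'n) \<Rightarrow> (real^'n \<Rightarrow> real) \<Rightarrow> real^'m^'m \<Rightarrow> real^'n \<Rightarrow> ereal"
  where
  "optimal_value f g h R x =
     Inf {cost h R y c | y c. c \<in> controls \<and> caratheodory_solution f g c x y}"


section \<open>Feedback controllers\<close>

text \<open>\<open>closed_loop f g u \<Omega> x y\<close>: on \<open>[0,\<infinity>)\<close>, \<open>y\<close> is a closed-loop trajectory from \<open>x\<close> under the feedback
  \<open>u\<close>, staying in the domain \<open>\<Omega>\<close> of \<open>u\<close>.\<close>

definition closed_loop ::
  "(real^'n \<Rightarrow> real^'n) \<Rightarrow> (real^'n \<Rightarrow> real^'m^'n) \<Rightarrow> (real^'n \<Rightarrow> real^'m) \<Rightarrow> (real^'n) set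
     \<Rightarrow> real^'n \<Rightarrow> (real \<Rightarrow> real^'n) \<Rightarrow> bool" where
  "closed_loop f g u \<Omega> x y \<longleftrightarrow>
     y 0 = x \<and>
     (\<forall>t\<ge>0. y t \<in> \<Omega> \<and>
        (y has_vector_derivative f (y t) + g (y t) *v u (y t)) (at t within {0..}))"

text \<open>A continuous feedback need not have unique closed-loop trajectories, so here and below a
  trajectory is required to exist and the stated properties are required of all trajectories.\<close>

definition admissible ::
  "(real^'n \<Rightarrow> real^'n) \<Rightarrow> (real^'n \<Rightarrow> real^'m^'n) \<Rightarrow> (real^'n \<Rightarrow> real^'m) \<Rightarrow> (real^'n) set \<Rightarrow> bool" where
  "admissible f g u \<Omega> \<longleftrightarrow>
     \<Omega> \<noteq> {} \<and> open \<Omega> \<and> connected \<Omega> \<and> continuous_on \<Omega> u \<and>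
     0 \<in> \<Omega> \<and> u 0 = 0 \<and>
     (\<forall>x\<in>\<Omega>. \<exists>y. closed_loop f g u \<Omega> x y) \<and>
     (\<forall>x\<in>\<Omega>. \<forall>y. closed_loop f g u \<Omega> x y \<longrightarrow> ((\<lambda>t. norm (y t)) \<longlongrightarrow> 0) at_top) \<and>
     (\<exists>\<epsilon>>0. \<exists>C>0. \<exists>\<nu>>0. ball 0 \<epsilon> \<subseteq> \<Omega> \<and>
        (\<forall>x\<in>ball 0 \<epsilon>. \<forall>y. closed_loop f g u \<Omega> x y \<longrightarrow>
           (\<forall>t\<ge>0. norm (y t) \<le> C * exp (- \<nu> * t) * norm x)))"

definition optimal_controller ::
  "(real^'n \<Rightarrow> real^'n) \<Rightarrow> (real^'n \<Rightarrow> real^'m^'n) \<Rightarrow> (real^'n \<Rightarrow> real) \<Rightarrow> real^'m^'m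
     \<Rightarrow> (real^'n \<Rightarrow> real^'m) \<Rightarrow> bool" where
  "optimal_controller f g h R u \<longleftrightarrow>
     continuous_on UNIV u \<and>
     (\<forall>x. (\<exists>y. closed_loop f g u UNIV x y) \<and>
          (\<forall>y. closed_loop f g u UNIV x y \<longrightarrow> cost h R y (\<lambda>t. u (y t)) = optimal_value f g h R x))"

definition policy_iteration ::
  "(real^'n \<Rightarrow> real^'n) \<Rightarrow> (real^'n \<Rightarrow> real^'m^'n) \<Rightarrow> (real^'n \<Rightarrow> real) \<Rightarrow> real^'m^'m
     \<Rightarrow> (real^'n \<Rightarrow> real^'m) \<Rightarrow> (nat \<Rightarrow> real^'n \<Rightarrow> real) \<Rightarrow> (nat \<Rightarrow> real^'n \<Rightarrow> real^'m) \<Rightarrow> bool" where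
  "policy_iteration f g h R u0 v u \<longleftrightarrow>
     u 0 = u0 \<and>
     (\<forall>s. C_diff 1 (v s) \<and>
          (\<forall>x. (f x + g x *v u s x) \<bullet> grad (v s) x + h x + u s x \<bullet> (R *v u s x) = 0) \<and>
          v s 0 = 0 \<and>
          (\<forall>x. u (Suc s) x = - (1/2) *\<^sub>R (matrix_inv R *v (transpose (g x) *v grad (v s) x))))"

end

theory Submission
  imports Defs "HOL-Complex_Analysis.Great_Picard"
begin

text \<open>
  Completing the square in the control shows that \<open>v\<^sub>s\<close> is a Lyapunov function for the
  feedback \<open>u\<^sub>s\<^sub>+\<^sub>1\<close>; it is proper because it dominates \<open>v\<^sup>*\<close>. Peano's theorem then yields closed-loop
  trajectories that tend to 0, along which integrating the linear equation identifies \<open>v\<^sub>s\<close> with the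
  cost of \<open>u\<^sub>s\<close> and integrating the dissipation of \<open>v\<^sub>s\<close> gives monotonicity.

  Under the uniform bounds the gradients are locally equi-Lipschitz, so the pointwise limit \<open>w\<close> of the
  monotone sequence \<open>v\<^sub>s\<close> is \<open>C\<^sup>1\<close>, the convergence is locally uniform in \<open>C\<^sup>1\<close>, and \<open>w\<close> solves
  the Hamilton-Jacobi-Bellman equation. Along an optimal trajectory \<open>y\<close> the function \<open>w\<close> decreases
  at most by the running cost, the defect being the squared \<open>R\<close>-norm of the difference between \<open>u\<^sup>*\<close> and the
  limit feedback. Since \<open>v\<^sup>*\<close> is the remaining cost along \<open>y\<close>, the trajectory stays bounded and
  visits every neighbourhood of 0. Hence \<open>w = v\<^sup>*\<close>, the defect vanishes, and the feedbacks agree.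
\<close>

section \<open>Integrals over the half-line\<close>

lemma mono_integral_nonneg:
  fixes L :: "real \<Rightarrow> real"
  assumes "continuous_on {0..} L" "\<And>t. 0 \<le> t \<Longrightarrow> 0 \<le> L t" "S \<le> T"
  shows "integral {0..S} L \<le> integral {0..T} L"
proof (rule integral_subset_le)
  show "L integrable_on {0..S}" "L integrable_on {0..T}"
    by (auto intro!: integrable_continuous_real continuous_on_subset[OF assms(1)])
qed (use assms in auto)

text \<open>Bridge between the cost, a Lebesgue integral with values in \<open>ennreal\<close>, and
  the Henstock-Kurzweil integrals over \<open>[0,T]\<close> that calculus along trajectories
  produces. Monotone convergence over the intervals \<open>[0,n]\<close> identifies the two.\<close>

lemma nn_integral_eq_limit:
  fixes L :: "real \<Rightarrow> real"
  assumes cont: "continuous_on {0..} L" and nn: "\<And>t. 0 \<le> t \<Longrightarrow> 0 \<le> L t"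
  shows "enn2ereal (\<integral>\<^sup>+ t. ennreal (L t) \<partial>lebesgue_on {0..}) = ereal r
    \<longleftrightarrow> ((\<lambda>T. integral {0..T} L) \<longlongrightarrow> r) at_top"
proof -
  define J where "J T = integral {0..T} L" for T
  define I where "I = (\<integral>\<^sup>+ t. ennreal (L t) \<partial>lebesgue_on {0..})"
  have J_mono: "J S \<le> J T" if "S \<le> T" for S T
    unfolding J_def using assms that by (rule mono_integral_nonneg)
  have L_int: "(L has_integral J T) {0..T}" for T
    unfolding J_def
    by (intro integrable_integral integrable_continuous_real continuous_on_subset[OF cont]) auto
  have J0: "0 \<le> J T" for T
    by (rule has_integral_nonneg[OF L_int]) (use nn in auto)
  \<comment> \<open>Only the values of \<open>L\<close> on the half-line are controlled. Extending
    it to the left by the constant \<open>L 0\<close> gives a continuous, hence Borel measurable,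
    function on the whole line.\<close>
  define L' where "L' t = L (max 0 t)" for t
  have "continuous_on UNIV L'"
    unfolding L'_def by (intro continuous_on_compose2[OF cont] continuous_intros) auto
  then have meas [measurable]: "L' \<in> borel_measurable borel"
    by (rule borel_measurable_continuous_onI)
  have "I = (\<integral>\<^sup>+ t. ennreal (L t) * indicator {0..} t \<partial>lebesgue)"
    unfolding I_def by (rule nn_integral_restrict_space) auto
  also have "\<dots> = (\<integral>\<^sup>+ t. ennreal (L t) * indicator {0..} t \<partial>lborel)"
    by (rule nn_integral_completion)
  also have "\<dots> = (\<integral>\<^sup>+ t. (SUP n. ennreal (L' t) * indicator {0..real n} t) \<partial>lborel)"
  proof (intro nn_integral_cong)
    fix t :: real
    have "(SUP n. ennreal (L' t) * indicator {0..real n} t) = ennreal (L' t) * (SUP n. indicator {0..real n} t)"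
      by (simp add: SUP_mult_left_ennreal)
    also have "(SUP n. indicator {0..real n} t) = (indicator {0..} t :: ennreal)"
    proof (cases "0 \<le> t")
      case True
      then obtain n where "t \<le> real n" using real_arch_simple by blast
      then have "(1::ennreal) \<le> (SUP n. indicator {0..real n} t)"
        using True by (intro SUP_upper2[of n]) auto
      then show ?thesis using True
        by (intro antisym SUP_least) (auto simp: indicator_def)
    qed (auto simp: indicator_def)
    finally show "ennreal (L t) * indicator {0..} t = (SUP n. ennreal (L' t) * indicator {0..real n} t)"
      by (auto simp: L'_def indicator_def)
  qed
  also have "\<dots> = (SUP n. (\<integral>\<^sup>+ t. ennreal (L' t) * indicator {0..real n} t \<partial>lborel))"
    by (rule nn_integral_monotone_convergence_SUP)
       (auto simp: incseq_def le_fun_def indicator_def)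
  also have "\<dots> = (SUP n. ennreal (J (real n)))"
  proof (intro SUP_cong refl)
    fix n :: nat
    have "(\<integral>\<^sup>+ t. ennreal (L' t) * indicator {0..real n} t \<partial>lborel)
       = (\<integral>\<^sup>+ t. ennreal (L t) * indicator {0..real n} t \<partial>lborel)"
      by (intro nn_integral_cong) (auto simp: L'_def indicator_def)
    also have "\<dots> = ennreal (J (real n))"
      by (rule nn_integral_has_integral_lebesgue'[OF _ L_int]) (use nn in auto)
    finally show "(\<integral>\<^sup>+ t. ennreal (L' t) * indicator {0..real n} t \<partial>lborel) = ennreal (J (real n))" .
  qed
  finally have I: "I = (SUP n. ennreal (J (real n)))" .
  have lim: "(\<lambda>n. ennreal (J (real n))) \<longlonglongrightarrow> I"
    unfolding I using J_mono by (intro LIMSEQ_SUP) (simp add: incseq_def ennreal_leI)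
  show ?thesis unfolding I_def[symmetric] J_def[symmetric]
  proof
    assume r: "enn2ereal I = ereal r"
    then have r0: "0 \<le> r" by (metis enn2ereal_nonneg ereal_less_eq(5))
    have "enn2ereal I = enn2ereal (ennreal r)" using r r0 by (simp add: enn2ereal_ennreal)
    then have "I = ennreal r" by (simp add: enn2ereal_inject)
    then have l: "(\<lambda>n. J (real n)) \<longlonglongrightarrow> r"
      using lim J0 r0 by simp
    \<comment> \<open>The limit is known along the integers; monotonicity of \<open>J\<close>
      carries it over to all real \<open>T\<close>.\<close>
    have "J T \<le> r" for T
    proof -
      obtain n where n: "T \<le> real n" using real_arch_simple by blast
      have "J T \<le> J (real n)" by (rule J_mono[OF n])
      also have "\<dots> \<le> r" using J_mono by (intro LIMSEQ_le_const[OF l] exI[of _ n]) simp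
      finally show ?thesis .
    qed
    then have "\<forall>\<^sub>F T in at_top. J T < a" if "r < a" for a
      using that by (intro always_eventually allI) (rule le_less_trans)
    moreover have "\<forall>\<^sub>F T in at_top. a < J T" if "a < r" for a
    proof -
      obtain n where "a < J (real n)"
        using order_tendstoD(1)[OF l \<open>a < r\<close>] by (auto simp: eventually_sequentially)
      then show ?thesis
        using J_mono by (intro eventually_at_top_linorderI[of "real n"]) (rule less_le_trans)
    qed
    ultimately show "(J \<longlongrightarrow> r) at_top"
      by (intro order_tendstoI)
  next
    assume l: "(J \<longlongrightarrow> r) at_top"
    have r0: "0 \<le> r" by (rule tendsto_lowerbound[OF l]) (auto simp: J0)
    have "(\<lambda>n. J (real n)) \<longlonglongrightarrow> r"
      using l filterlim_real_sequentially by (rule filterlim_compose)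
    then have "(\<lambda>n. ennreal (J (real n))) \<longlonglongrightarrow> ennreal r" by (rule tendsto_ennrealI)
    with lim have "I = ennreal r" by (rule LIMSEQ_unique)
    then show "enn2ereal I = ereal r" using r0 by (simp add: enn2ereal_ennreal)
  qed
qed

section \<open>Peano's existence theorem\<close>

lemma norm_integral_diff_le:
  fixes G :: "real \<Rightarrow> 'a::euclidean_space"
  assumes "continuous_on {0..T} G" "\<And>t. norm (G t) \<le> M" "a \<in> {0..T}" "b \<in> {0..T}"
  shows "norm (integral {0..a} G - integral {0..b} G) \<le> M * \<bar>a - b\<bar>"
proof -
  have *: "norm (integral {0..b} G - integral {0..a} G) \<le> M * (b - a)"
    if "0 \<le> a" "a \<le> b" "b \<le> T" for a b
  proof -
    have "integral {0..a} G + integral {a..b} G = integral {0..b} G"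
      using that by (intro Henstock_Kurzweil_Integration.integral_combine integrable_continuous_real
          continuous_on_subset[OF assms(1)]) auto
    then have "integral {0..b} G - integral {0..a} G = integral {a..b} G"
      by (simp add: algebra_simps)
    also have "norm \<dots> \<le> M * (b - a)"
      using that assms(2) by (intro integral_bound continuous_on_subset[OF assms(1)]) auto
    finally show ?thesis .
  qed
  show ?thesis
    using *[of a b] *[of b a] assms(3,4) by (cases "a \<le> b") (auto simp: norm_minus_commute)
qed

text \<open>Tonelli's scheme: with a delay the equation can be solved step by step. The solutions
  for the delays \<open>1 / (n + 1)\<close> share the Lipschitz constant \<open>M\<close>,
  Arzela-Ascoli extracts a uniform limit, and dominated convergence removes the delay. The improved
  feedbacks are known to be continuous only, hence existence in the style of Peano.\<close>

lemma peano_unit_interval: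
  fixes F :: "'a::euclidean_space \<Rightarrow> 'a"
  assumes F: "continuous_on UNIV F" and M: "\<And>z. norm (F z) \<le> M"
  shows "\<exists>y::real \<Rightarrow> 'a. continuous_on {0..1} y \<and> (\<forall>t\<in>{0..1}. y t = x + integral {0..t} (\<lambda>s. F (y s)))"
proof -
  have M0: "0 \<le> M" using M[of 0] norm_ge_zero order_trans by blast
  have delayed: "\<exists>z. continuous_on {0..1} z \<and>
      (\<forall>t\<in>{0..1}. z t = x + integral {0..max 0 (t - \<delta>)} (\<lambda>s. F (z s)))" if "0 < \<delta>" for \<delta> :: real
  proof -
    \<comment> \<open>Because of the delay, the \<open>k\<close>-th Picard iterate is already a solution on \<open>[0, k \<delta>]\<close>.\<close>
    define Y where "Y = rec_nat (\<lambda>_. x) (\<lambda>_ Z t. x + integral {0..max 0 (t - \<delta>)} (\<lambda>s. F (Z s)))"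
    have Y0: "Y 0 = (\<lambda>_. x)"
      and YS: "Y (Suc k) = (\<lambda>t. x + integral {0..max 0 (t - \<delta>)} (\<lambda>s. F (Y k s)))" for k
      unfolding Y_def by simp_all
    have cont: "continuous_on {0..1} (Y k)" for k
    proof (induction k)
      case (Suc k)
      then have "continuous_on {0..1} (\<lambda>s. F (Y k s))"
        by (intro continuous_on_compose2[OF F]) auto
      then have "continuous_on {0..1} (\<lambda>t. integral {0..t} (\<lambda>s. F (Y k s)))"
        by (intro indefinite_integral_continuous_1 integrable_continuous_real)
      then have "continuous_on {0..1} (\<lambda>t. integral {0..max 0 (t - \<delta>)} (\<lambda>s. F (Y k s)))"
        by (rule continuous_on_compose2) (use that in \<open>auto intro!: continuous_intros\<close>)
      then show ?case unfolding YS by (intro continuous_intros)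
    qed (simp add: Y0)
    have stable: "Y (Suc k) t = Y k t" if "t \<le> real k * \<delta>" for k t
      using that
    proof (induction k arbitrary: t)
      \<comment> \<open>For \<open>t \<le> 0\<close> the integral runs over \<open>{0..0}\<close>,
        so both iterates equal \<open>x\<close>.\<close>
      case 0
      then show ?case using \<open>0 < \<delta>\<close> by (simp add: Y0 YS max_def)
    next
      case (Suc k)
      have "integral {0..max 0 (t - \<delta>)} (\<lambda>s. F (Y (Suc k) s)) = integral {0..max 0 (t - \<delta>)} (\<lambda>s. F (Y k s))"
      proof (rule integral_cong)
        fix s assume "s \<in> {0..max 0 (t - \<delta>)}"
        moreover have "0 \<le> real k * \<delta>" using \<open>0 < \<delta>\<close> by simp
        ultimately have "s \<le> real k * \<delta>" using Suc.prems by (auto simp: algebra_simps)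
        then show "F (Y (Suc k) s) = F (Y k s)" using Suc.IH by simp
      qed
      then show ?case by (simp only: YS[of "Suc k"] YS[of k])
    qed
    obtain k where "1 / \<delta> \<le> real k" using real_arch_simple by blast
    then have k: "1 \<le> real k * \<delta>" using that by (simp add: field_simps)
    show ?thesis
    proof (intro exI[of _ "Y k"] conjI ballI cont)
      fix t :: real assume "t \<in> {0..1}"
      then have "t \<le> real k * \<delta>" using k by auto
      from stable[OF this, symmetric] show "Y k t = x + integral {0..max 0 (t - \<delta>)} (\<lambda>s. F (Y k s))"
        by (simp only: YS)
    qed
  qed
  define d where "d n = 1 / real (Suc n)" for n
  have "\<forall>n. \<exists>z. continuous_on {0..1} z \<and>
      (\<forall>t\<in>{0..1}. z t = x + integral {0..max 0 (t - d n)} (\<lambda>s. F (z s)))"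
    using delayed by (simp add: d_def)
  then obtain z where z: "\<And>n. continuous_on {0..1} (z n)"
      "\<And>n t. t \<in> {0..1} \<Longrightarrow> z n t = x + integral {0..max 0 (t - d n)} (\<lambda>s. F (z n s))"
    by metis
  have d0: "0 < d n" for n by (simp add: d_def)
  have Fz: "continuous_on {0..1} (\<lambda>s. F (z n s))" for n
    by (rule continuous_on_compose2[OF F z(1)]) auto
  have in01: "max 0 (t - d n) \<in> {0..1}" if "t \<in> {0..1}" for t n
    using that d0[of n] by auto
  have lip: "norm (z n t - z n s) \<le> M * \<bar>t - s\<bar>" if "t \<in> {0..1}" "s \<in> {0..1}" for n t s
  proof -
    have "norm (z n t - z n s) \<le> M * \<bar>max 0 (t - d n) - max 0 (s - d n)\<bar>"
      unfolding z(2)[OF that(1)] z(2)[OF that(2)]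
      using norm_integral_diff_le[OF Fz[of n] M in01[OF that(1), of n] in01[OF that(2), of n]] by simp
    also have "\<dots> \<le> M * \<bar>t - s\<bar>" using M0 by (intro mult_left_mono) auto
    finally show ?thesis .
  qed
  have approx: "norm (x + integral {0..t} (\<lambda>s. F (z n s)) - z n t) \<le> M * d n" if "t \<in> {0..1}" for n t
  proof -
    have "norm (x + integral {0..t} (\<lambda>s. F (z n s)) - z n t) \<le> M * \<bar>t - max 0 (t - d n)\<bar>"
      unfolding z(2)[OF that] using norm_integral_diff_le[OF Fz[of n] M that in01[OF that, of n]] by simp
    also have "\<dots> \<le> M * d n" using M0 d0[of n] that by (intro mult_left_mono) auto
    finally show ?thesis .
  qed
  have z0: "z n 0 = x" for n using z(2)[of 0 n] d0[of n] by (simp add: max_def)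
  obtain y k where y: "continuous_on {0..1} y" "strict_mono (k :: nat \<Rightarrow> nat)"
     "\<And>e. 0 < e \<Longrightarrow> \<exists>N. \<forall>n t. n \<ge> N \<and> t \<in> {0..1} \<longrightarrow> norm (z (k n) t - y t) < e"
  proof (rule Arzela_Ascoli[of "{0..1::real}" z "norm x + M"])
    fix n and t :: real assume t: "t \<in> {0..1}"
    have "norm (z n t) \<le> norm (z n 0) + norm (z n t - z n 0)" by (rule norm_triangle_sub)
    also have "norm (z n t - z n 0) \<le> M * \<bar>t - 0\<bar>" using t by (intro lip) auto
    also have "\<dots> \<le> M * 1" using t M0 by (intro mult_left_mono) auto
    finally show "norm (z n t) \<le> norm x + M" by (simp add: z0)
  next
    fix t e :: real assume t: "t \<in> {0..1}" and e: "0 < e"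
    show "\<exists>\<eta>. 0 < \<eta> \<and> (\<forall>n s. s \<in> {0..1} \<and> norm (t - s) < \<eta> \<longrightarrow> norm (z n t - z n s) < e)"
    \<comment> \<open>\<open>M\<close> may be 0, so the modulus is taken with
      \<open>M + 1\<close>.\<close>
    proof (intro exI[of _ "e / (M + 1)"] conjI allI impI)
      show "0 < e / (M + 1)" using e M0 by simp
      fix n s assume s: "s \<in> {0..1} \<and> norm (t - s) < e / (M + 1)"
      have "norm (z n t - z n s) \<le> M * \<bar>t - s\<bar>" using s t by (intro lip) auto
      also have "\<dots> \<le> (M + 1) * \<bar>t - s\<bar>" by (intro mult_right_mono) auto
      also have "\<dots> < e" using s M0 by (simp add: pos_less_divide_eq mult.commute)
      finally show "norm (z n t - z n s) < e" .
    qed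
  qed (auto intro: that)
  have zy: "(\<lambda>n. z (k n) t) \<longlonglongrightarrow> y t" if "t \<in> {0..1}" for t
    using y(3) that by (intro LIMSEQ_I) blast
  have "y t = x + integral {0..t} (\<lambda>s. F (y s))" if t: "t \<in> {0..1}" for t
  proof -
    have "(\<lambda>n. integral {0..t} (\<lambda>s. F (z (k n) s))) \<longlonglongrightarrow> integral {0..t} (\<lambda>s. F (y s))"
    proof (rule dominated_convergence(2)[where h = "\<lambda>_. M"])
      show "(\<lambda>s. F (z (k n) s)) integrable_on {0..t}" for n
        using t by (intro integrable_continuous_real continuous_on_subset[OF Fz]) auto
      show "(\<lambda>n. F (z (k n) s)) \<longlonglongrightarrow> F (y s)" if "s \<in> {0..t}" for s
        using F zy[of s] that t by (intro isCont_tendsto_compose[of "y s" F]) (auto simp: continuous_on_eq_continuous_at)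
    qed (auto simp: M)
    \<comment> \<open>The defect of the delayed solution in the undelayed equation has two limits:
      the defect of \<open>y\<close>, and 0 because it is at most \<open>M\<close> times the
      delay.\<close>
    then have "(\<lambda>n. x + integral {0..t} (\<lambda>s. F (z (k n) s)) - z (k n) t)
        \<longlonglongrightarrow> x + integral {0..t} (\<lambda>s. F (y s)) - y t"
      using zy[OF t] by (intro tendsto_intros)
    moreover have "(\<lambda>n. x + integral {0..t} (\<lambda>s. F (z (k n) s)) - z (k n) t) \<longlonglongrightarrow> 0"
    proof (rule Lim_null_comparison)
      show "\<forall>\<^sub>F n in sequentially. norm (x + integral {0..t} (\<lambda>s. F (z (k n) s)) - z (k n) t) \<le> M * d (k n)"
        using approx[OF t] by simp
      have "d \<longlonglongrightarrow> 0" unfolding d_def using LIMSEQ_inverse_real_of_nat by (simp add: inverse_eq_divide)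
      then have "(d \<circ> k) \<longlonglongrightarrow> 0" using y(2) by (rule LIMSEQ_subseq_LIMSEQ)
      then show "(\<lambda>n. M * d (k n)) \<longlonglongrightarrow> 0" by (simp add: o_def tendsto_mult_right_zero)
    qed
    ultimately show ?thesis using LIMSEQ_unique by fastforce
  qed
  then show ?thesis using y(1) by (intro exI[of _ y]) simp
qed

text \<open>The global bound on \<open>F\<close> makes the length of the existence interval
  independent of the initial value, so solutions on unit intervals can be glued end to end.\<close>

lemma peano_half_line:
  fixes F :: "'a::euclidean_space \<Rightarrow> 'a"
  assumes F: "continuous_on UNIV F" and M: "\<And>z. norm (F z) \<le> M"
  obtains y where "y 0 = x" "\<And>t. 0 \<le> t \<Longrightarrow> (y has_vector_derivative F (y t)) (at t within {0..})"
proof -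
  obtain S :: "'a \<Rightarrow> real \<Rightarrow> 'a" where S: "\<And>x. continuous_on {0..1} (S x)"
      "\<And>x t. t \<in> {0..1} \<Longrightarrow> S x t = x + integral {0..t} (\<lambda>s. F (S x s))"
    using peano_unit_interval[OF F M] by metis
  \<comment> \<open>\<open>p n\<close> is the state reached at time \<open>n\<close>, from which the
    next unit piece starts.\<close>
  define p where "p = rec_nat x (\<lambda>_ z. S z 1)"
  have p0: "p 0 = x" and pS: "p (Suc n) = S (p n) 1" for n
    by (simp_all add: p_def)
  have S0: "S z 0 = z" for z using S(2)[of 0 z] by simp
  define y where "y t = S (p (nat \<lfloor>t\<rfloor>)) (t - of_int \<lfloor>t\<rfloor>)" for t :: real
  have y_piece: "y t = S (p n) (t - real n)" if "t \<in> {real n..real (Suc n)}" for t n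
  \<comment> \<open>At the right endpoint the floor has already jumped to \<open>n + 1\<close>, so
    \<open>y\<close> is read off the next piece; the two agree because that piece starts at
    \<open>S (p n) 1\<close>.\<close>
  proof (cases "t = real (Suc n)")
    case True
    then have "\<lfloor>t\<rfloor> = int (Suc n)" by linarith
    then have "y t = S (p (Suc n)) 0" unfolding y_def using True by (simp del: of_nat_Suc)
    then show ?thesis using True by (simp add: S0 pS)
  next
    case False
    then have "\<lfloor>t\<rfloor> = int n" using that by (simp add: floor_eq_iff)
    then show ?thesis unfolding y_def by simp
  qed
  have ypn: "y (real n) = p n" for n
    using y_piece[of "real n" n] by (simp add: S0)
  have cont_piece: "continuous_on {real n..real (Suc n)} y" for n
  proof -
    have "continuous_on {real n..real (Suc n)} (\<lambda>t. S (p n) (t - real n))"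
      by (intro continuous_on_compose2[OF S(1)] continuous_intros) auto
    then show ?thesis
      by (rule continuous_on_eq) (simp add: y_piece)
  qed
  have cont_n: "continuous_on {0..real n} y" for n
  proof (induction n)
    case (Suc n)
    have "{0..real (Suc n)} = {0..real n} \<union> {real n..real (Suc n)}" by auto
    with continuous_on_closed_Un[OF _ _ Suc cont_piece] show ?case by simp
  qed simp
  have Fcont_n: "continuous_on {0..real n} (\<lambda>s. F (y s))" for n
    by (rule continuous_on_compose2[OF F cont_n]) auto
  have int: "(\<lambda>s. F (y s)) integrable_on {a..b}" if "0 \<le> a" for a b
  proof -
    obtain n where "b \<le> real n" using real_arch_simple by blast
    with that show ?thesis
      by (intro integrable_continuous_real continuous_on_subset[OF Fcont_n[of n]]) auto
  qed
  have eq_n: "\<forall>t\<in>{0..real n}. y t = x + integral {0..t} (\<lambda>s. F (y s))" for n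
  proof (induction n)
    case 0
    then show ?case using ypn[of 0] by (simp add: p0)
  next
    case (Suc n)
    show ?case
    proof
      fix t assume t: "t \<in> {0..real (Suc n)}"
      show "y t = x + integral {0..t} (\<lambda>s. F (y s))"
      proof (cases "t \<le> real n")
        case True
        then show ?thesis using Suc t by auto
      next
        case False
        then have t': "t \<in> {real n..real (Suc n)}" using t by auto
        have "y t = p n + integral {0..t - real n} (\<lambda>s. F (S (p n) s))"
          unfolding y_piece[OF t'] using t' by (intro S(2)) auto
        also have "integral {0..t - real n} (\<lambda>s. F (S (p n) s)) = integral {0..t - real n} (\<lambda>s. F (y (s + real n)))"
          using t' by (intro integral_cong) (subst y_piece[of _ n], auto)
        also have "\<dots> = integral {real n..t} (\<lambda>s. F (y s))"
        proof -
          have "((\<lambda>s. F (y s)) has_integral integral {real n..t} (\<lambda>s. F (y s))) {real n..t}"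
            by (intro integrable_integral int) simp
          from has_integral_affinity'[OF this[folded box_real], of 1 "real n"]
          show ?thesis by (intro integral_unique) (simp add: add.commute)
        qed
        also have "p n = x + integral {0..real n} (\<lambda>s. F (y s))"
          using Suc ypn[of n] by auto
        also have "x + integral {0..real n} (\<lambda>s. F (y s)) + integral {real n..t} (\<lambda>s. F (y s))
            = x + integral {0..t} (\<lambda>s. F (y s))"
          using Henstock_Kurzweil_Integration.integral_combine[of 0 "real n" t "\<lambda>s. F (y s)"] False int
          by (simp add: add.assoc)
        finally show ?thesis .
      qed
    qed
  qed
  show thesis
  proof (rule that)
    show "y 0 = x" using ypn[of 0] by (simp add: p0)
    fix t :: real assume t: "0 \<le> t"
    \<comment> \<open>\<open>n\<close> lies strictly beyond \<open>t\<close>, so that near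
      \<open>t\<close> the interval \<open>{0..n}\<close> coincides with the half-line.\<close>
    obtain n where n: "t < real n" using reals_Archimedean2 by blast
    have "((\<lambda>s. x + integral {0..s} (\<lambda>s. F (y s))) has_vector_derivative (0 + F (y t))) (at t within {0..real n})"
      using t n by (intro has_vector_derivative_add has_vector_derivative_const
          integral_has_vector_derivative Fcont_n) auto
    then have "(y has_vector_derivative F (y t)) (at t within {0..real n})"
      using eq_n[of n] t n by (auto intro: has_vector_derivative_transform[rotated 2])
    moreover have "at t within {0..real n} = at t within {0..}"
      using n t by (intro at_within_nhd[of t "{..<real n}"]) auto
    ultimately show "(y has_vector_derivative F (y t)) (at t within {0..})" by simp
  qed
qed

section \<open>Lyapunov functions\<close>

lemma has_vector_derivative_along:
  assumes "GDERIV V (y t) :> d" "(y has_vector_derivative w) (at t within S)"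
  shows "((\<lambda>t. V (y t)) has_vector_derivative w \<bullet> d) (at t within S)"
  using vector_derivative_diff_chain_within[OF assms(2), of V "\<lambda>h. h \<bullet> d"] assms(1)
  by (simp add: gderiv_def o_def has_derivative_at_withinI)

lemma has_integral_along:
  fixes y :: "real \<Rightarrow> 'a::real_inner"
  assumes V: "\<And>z. GDERIV V z :> D z"
    and y: "\<And>t. 0 \<le> t \<Longrightarrow> (y has_vector_derivative w t) (at t within {0..})"
    and S: "0 \<le> S" "S \<le> T"
  shows "((\<lambda>t. w t \<bullet> D (y t)) has_integral (V (y T) - V (y S))) {S..T}"
proof (rule fundamental_theorem_of_calculus[OF \<open>S \<le> T\<close>])
  fix t assume t: "t \<in> {S..T}"
  then have "(y has_vector_derivative w t) (at t within {S..T})"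
    using S by (intro has_vector_derivative_within_subset[OF y]) auto
  then show "((\<lambda>t. V (y t)) has_vector_derivative w t \<bullet> D (y t)) (at t within {S..T})"
    by (intro has_vector_derivative_along V)
qed

lemma continuous_on_trajectory:
  assumes "\<And>t. 0 \<le> t \<Longrightarrow> (y has_vector_derivative w t) (at t within {0..})"
  shows "continuous_on {0..} y"
  unfolding continuous_on_eq_continuous_within
  using has_vector_derivative_continuous[OF assms] by simp

text \<open>Fundamental theorem of calculus for \<open>V\<close> along \<open>y\<close>, with the
  pointwise rate integrated. It serves both the Lyapunov estimates, where \<open>L\<close> is a
  decay rate, and the comparison of policies, where \<open>L\<close> is the running cost.\<close>

lemma dissipation_inequality:
  fixes y :: "real \<Rightarrow> 'a::real_inner"
  assumes V: "\<And>z. GDERIV V z :> D z"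
    and y: "\<And>t. 0 \<le> t \<Longrightarrow> (y has_vector_derivative w t) (at t within {0..})"
    and L: "continuous_on {0..} L" "\<And>t. 0 \<le> t \<Longrightarrow> w t \<bullet> D (y t) \<le> - L t"
    and S: "0 \<le> S" "S \<le> T"
  shows "V (y T) + integral {S..T} L \<le> V (y S)"
proof -
  have "(L has_integral integral {S..T} L) {S..T}"
    using S by (intro integrable_integral integrable_continuous_real continuous_on_subset[OF L(1)]) auto
  then have "((\<lambda>t. - L t) has_integral - integral {S..T} L) {S..T}"
    by (rule has_integral_neg)
  with has_integral_along[OF V y S] have "V (y T) - V (y S) \<le> - integral {S..T} L"
    by (rule has_integral_le) (use L(2) S in auto)
  then show ?thesis by simp
qed

text \<open>A trajectory confined to the annulus between \<epsilon> and \<open>B\<close> would keep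
  \<open>h\<close> above its positive minimum there, and the integral would grow linearly past
  \<open>M\<close>. Convergence of \<open>y\<close> is not presupposed, so the argument also covers
  optimal trajectories.\<close>

lemma trajectory_visits_ball:
  fixes y :: "real \<Rightarrow> 'a::euclidean_space" and h :: "'a \<Rightarrow> real"
  assumes h: "continuous_on UNIV h" "\<And>z. z \<noteq> 0 \<Longrightarrow> 0 < h z"
    and y: "continuous_on {0..} y" "\<And>t. 0 \<le> t \<Longrightarrow> norm (y t) \<le> B"
    and M: "\<And>T. 0 \<le> T \<Longrightarrow> integral {0..T} (\<lambda>t. h (y t)) \<le> M"
    and "0 < \<epsilon>"
  shows "\<exists>T\<ge>0. norm (y T) < \<epsilon>"
proof (rule ccontr)
  assume "\<not> ?thesis"
  then have far: "y t \<in> cball 0 B - ball 0 \<epsilon>" if "0 \<le> t" for t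
    using y(2)[OF that] that by (auto simp: not_less)
  have "compact (cball 0 B - ball 0 \<epsilon> :: 'a set)" by (intro compact_diff) auto
  then obtain k where k: "k \<in> cball 0 B - ball 0 \<epsilon>" "\<And>z. z \<in> cball 0 B - ball 0 \<epsilon> \<Longrightarrow> h k \<le> h z"
    using continuous_attains_inf[OF _ _ continuous_on_subset[OF h(1)]] far[of 0]
    by (metis empty_iff order_refl subset_UNIV)
  have hk: "0 < h k" using k(1) \<open>0 < \<epsilon>\<close> by (intro h(2)) auto
  \<comment> \<open>Long enough for the minimum \<open>h k\<close> alone to accumulate
    \<open>\<bar>M\<bar> + 1\<close>, which exceeds \<open>M\<close>.\<close>
  define T where "T = (\<bar>M\<bar> + 1) / h k"
  have T: "0 \<le> T" unfolding T_def using hk by simp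
  have "continuous_on {0..} (\<lambda>t. h (y t))"
    by (rule continuous_on_compose2[OF h(1) y(1)]) auto
  then have int_hy: "((\<lambda>t. h (y t)) has_integral integral {0..T} (\<lambda>t. h (y t))) {0..T}"
    by (intro integrable_integral integrable_continuous_real) (auto intro: continuous_on_subset)
  have int_k: "((\<lambda>t. h k) has_integral (T - 0) *\<^sub>R h k) {0..T}"
    using has_integral_const_real[of "h k" 0 T] T by simp
  have "(T - 0) *\<^sub>R h k \<le> integral {0..T} (\<lambda>t. h (y t))"
    by (rule has_integral_le[OF int_k int_hy]) (simp add: k(2)[OF far])
  also have "\<dots> \<le> M" by (rule M[OF T])
  finally show False using hk by (simp add: T_def)
qed

text \<open>\<open>V\<close> bounds the accumulated \<open>W\<close> and is proper, so the
  trajectory stays in a ball and visits every neighbourhood of 0. Once \<open>V\<close> is small it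
  stays small, and inside the ball small \<open>V\<close> forces small norm; this turns visiting
  into convergence.\<close>

lemma lyapunov_trajectory_tendsto:
  fixes y :: "real \<Rightarrow> 'a::euclidean_space" and V W :: "'a \<Rightarrow> real"
  assumes V: "\<And>z. GDERIV V z :> D z" "V 0 = 0" "\<And>z. z \<noteq> 0 \<Longrightarrow> 0 < V z" "\<And>c. bounded {z. V z \<le> c}"
    and W: "continuous_on UNIV W" "\<And>z. z \<noteq> 0 \<Longrightarrow> 0 < W z" "W 0 = 0"
    and FW: "\<And>z. F z \<bullet> D z \<le> - W z"
    and y: "\<And>t. 0 \<le> t \<Longrightarrow> (y has_vector_derivative F (y t)) (at t within {0..})"
  shows "(y \<longlongrightarrow> 0) at_top"
proof -
  have V_nonneg: "0 \<le> V z" and W_nonneg: "0 \<le> W z" for z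
    using V(2) V(3)[of z] W(2)[of z] W(3) by (cases "z = 0"; simp)+
  have contV: "continuous_on UNIV V"
    using V(1) by (auto simp: continuous_on_eq_continuous_at gderiv_def intro: has_derivative_continuous)
  have conty: "continuous_on {0..} y" by (rule continuous_on_trajectory[OF y])
  have contW: "continuous_on {0..} (\<lambda>t. W (y t))"
    by (rule continuous_on_compose2[OF W(1) conty]) auto
  have diss: "V (y T) + integral {S..T} (\<lambda>t. W (y t)) \<le> V (y S)" if "0 \<le> S" "S \<le> T" for S T
    using V(1) y contW FW that by (rule dissipation_inequality)
  have int_nonneg: "0 \<le> integral {S..T} (\<lambda>t. W (y t))" if "0 \<le> S" for S T
    using that by (intro integral_nonneg integrable_continuous_real continuous_on_subset[OF contW] W_nonneg) auto
  have decr: "V (y T) \<le> V (y S)" if "0 \<le> S" "S \<le> T" for S T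
    using diss[OF that] int_nonneg[OF that(1), of T] by linarith
  obtain B where B: "\<And>z. V z \<le> V (y 0) \<Longrightarrow> norm z \<le> B"
    using V(4)[of "V (y 0)"] by (auto simp: bounded_iff)
  show ?thesis
  proof (rule tendstoI)
    fix \<epsilon> :: real assume \<epsilon>: "0 < \<epsilon>"
    have "\<exists>\<eta>>0. \<forall>z. norm z \<le> B \<longrightarrow> V z < \<eta> \<longrightarrow> norm z < \<epsilon>"
    \<comment> \<open>On an empty annulus \<open>V\<close> has no minimum; in that case all points
      of the ball have norm below \<epsilon>.\<close>
    proof (cases "cball 0 B - ball 0 \<epsilon> = ({} :: 'a set)")
      case True
      then have "norm z < \<epsilon>" if "norm z \<le> B" for z :: 'a
        using that by (metis Diff_iff emptyE mem_ball_0 mem_cball_0)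
      then show ?thesis by (intro exI[of _ 1]) simp
    next
      case False
      have "compact (cball 0 B - ball 0 \<epsilon> :: 'a set)" by (intro compact_diff) auto
      then obtain k where k: "k \<in> cball 0 B - ball 0 \<epsilon>" "\<And>z. z \<in> cball 0 B - ball 0 \<epsilon> \<Longrightarrow> V k \<le> V z"
        using continuous_attains_inf[OF _ False continuous_on_subset[OF contV]] by blast
      have "0 < V k" using k(1) \<epsilon> by (intro V(3)) auto
      moreover have "norm z < \<epsilon>" if "norm z \<le> B" "V z < V k" for z
        using k(2)[of z] that by fastforce
      ultimately show ?thesis by blast
    qed
    then obtain \<eta> where \<eta>: "0 < \<eta>" "\<And>z. norm z \<le> B \<Longrightarrow> V z < \<eta> \<Longrightarrow> norm z < \<epsilon>" by blast
    obtain \<delta> where \<delta>: "0 < \<delta>" "\<And>z. norm z < \<delta> \<Longrightarrow> V z < \<eta>"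
    proof -
      have "isCont V 0" using contV by (simp add: continuous_on_eq_continuous_at)
      then obtain \<delta> where "0 < \<delta>" "\<And>z. dist z 0 < \<delta> \<Longrightarrow> dist (V z) (V 0) < \<eta>"
        using \<eta>(1) by (auto simp: continuous_at_eps_delta dist_norm)
      then show thesis using V(2) by (intro that) (auto simp: dist_norm abs_less_iff)
    qed
    have "\<exists>T\<ge>0. norm (y T) < \<delta>"
    proof (rule trajectory_visits_ball[OF W(1) W(2) conty _ _ \<delta>(1)])
      show "norm (y t) \<le> B" if "0 \<le> t" for t using decr[of 0 t] that by (intro B) simp
      show "integral {0..T} (\<lambda>t. W (y t)) \<le> V (y 0)" if "0 \<le> T" for T
        using diss[of 0 T] V_nonneg[of "y T"] that by simp
    qed auto
    then obtain T where T: "0 \<le> T" "norm (y T) < \<delta>" by blast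
    show "\<forall>\<^sub>F t in at_top. dist (y t) 0 < \<epsilon>"
    proof (rule eventually_at_top_linorderI[of T])
      fix t assume "T \<le> t"
      then have "V (y t) \<le> V (y T)" "V (y t) \<le> V (y 0)" using T(1) by (auto intro: decr)
      then have "norm (y t) \<le> B" "V (y t) < \<eta>"
        using B \<delta>(2)[OF T(2)] by auto
      then show "dist (y t) 0 < \<epsilon>" using \<eta>(2) by simp
    qed
  qed
qed

text \<open>Multiplying \<open>F\<close> by a cutoff makes it bounded and keeps \<open>V\<close> nonincreasing along trajectories,
  so a trajectory of the truncated field never leaves the region where the cutoff is 1.\<close>

lemma lyapunov_trajectory_exists:
  fixes F :: "'a::euclidean_space \<Rightarrow> 'a"
  assumes V: "\<And>z. GDERIV V z :> D z" "\<And>c. bounded {z. V z \<le> c}"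
    and F: "continuous_on UNIV F" "\<And>z. F z \<bullet> D z \<le> 0"
  obtains y where "y 0 = x" "\<And>t. 0 \<le> t \<Longrightarrow> (y has_vector_derivative F (y t)) (at t within {0..})"
proof -
  obtain r where r: "\<And>z. V z \<le> V x \<Longrightarrow> norm z \<le> r"
    using V(2)[of "V x"] by (auto simp: bounded_iff)
  \<comment> \<open>Equal to 1 on the ball of radius \<open>r\<close>, which contains the sublevel
    set of \<open>V\<close> at \<open>V x\<close>, and to 0 beyond radius \<open>r + 1\<close>; a
    bound for \<open>F\<close> on the larger ball therefore bounds \<open>G\<close>
    everywhere.\<close>
  define \<phi> where "\<phi> z = max 0 (min 1 (r + 1 - norm z))" for z :: 'a
  define G where "G z = \<phi> z *\<^sub>R F z" for z
  have contG: "continuous_on UNIV G"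
    unfolding G_def \<phi>_def by (intro continuous_intros F(1))
  have "compact (F ` cball 0 (r + 1))"
    by (intro compact_continuous_image continuous_on_subset[OF F(1)]) auto
  then obtain M where M: "\<And>z. norm z \<le> r + 1 \<Longrightarrow> norm (F z) \<le> M"
    using compact_imp_bounded by (force simp: bounded_iff)
  have boundG: "norm (G z) \<le> max 0 M" for z
  proof (cases "norm z \<le> r + 1")
    case True
    have "norm (G z) \<le> 1 * norm (F z)"
      unfolding G_def norm_scaleR by (intro mult_right_mono) (auto simp: \<phi>_def)
    then show ?thesis using M[OF True] by simp
  qed (simp add: G_def \<phi>_def)
  obtain y where y: "y 0 = x" "\<And>t. 0 \<le> t \<Longrightarrow> (y has_vector_derivative G (y t)) (at t within {0..})"
    using peano_half_line[OF contG boundG] by blast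
  have "V (y t) + integral {0..t} (\<lambda>_. 0) \<le> V (y 0)" if "0 \<le> t" for t
  proof (rule dissipation_inequality[OF V(1) y(2)])
    show "G (y t) \<bullet> D (y t) \<le> - 0" for t
      using F(2)[of "y t"] by (simp add: G_def \<phi>_def mult_nonneg_nonpos)
  qed (use that in auto)
  then have "norm (y t) \<le> r" if "0 \<le> t" for t using that y(1) by (intro r) simp
  then have "G (y t) = F (y t)" if "0 \<le> t" for t using that by (simp add: G_def \<phi>_def)
  with y(2) have "(y has_vector_derivative F (y t)) (at t within {0..})" if "0 \<le> t" for t
    using that by metis
  with y(1) show thesis by (rule that)
qed

section \<open>Limits of functions with equi-Lipschitz gradients\<close>

text \<open>On a finite net the convergence is simultaneous, and the common Lipschitz constant,
  which the limit inherits, transfers it to all nearby points.\<close>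

lemma uniform_limit_equi_lipschitz:
  fixes F :: "nat \<Rightarrow> 'a::metric_space \<Rightarrow> 'b::metric_space"
  assumes K: "compact K"
    and lip: "\<And>s x y. x \<in> K \<Longrightarrow> y \<in> K \<Longrightarrow> dist (F s x) (F s y) \<le> L * dist x y"
    and lim: "\<And>x. x \<in> K \<Longrightarrow> (\<lambda>s. F s x) \<longlonglongrightarrow> G x"
  shows "uniform_limit K F G sequentially"
proof (rule uniform_limitI)
  fix e :: real assume e: "0 < e"
  \<comment> \<open>\<open>L\<close> may be zero or negative, for instance when \<open>K\<close> is
    a single point; a positive constant is needed to divide by.\<close>
  define L' where "L' = \<bar>L\<bar> + 1"
  have L': "0 < L'" "L \<le> L'" by (auto simp: L'_def)
  have lip': "dist (F s x) (F s y) \<le> L' * dist x y" if "x \<in> K" "y \<in> K" for s x y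
    using lip[OF that, of s] mult_right_mono[OF L'(2) zero_le_dist, of x y] by linarith
  have lipG: "dist (G x) (G y) \<le> L' * dist x y" if "x \<in> K" "y \<in> K" for x y
    by (rule tendsto_upperbound[OF tendsto_dist[OF lim lim]]) (use that lip' in auto)
  define d where "d = e / (3 * L')"
  have d: "0 < d" "L' * d = e / 3" using e L' by (auto simp: d_def field_simps)
  obtain k where k: "finite k" "k \<subseteq> K" "K \<subseteq> (\<Union>c\<in>k. ball c d)"
    using compactE_image[OF K, of K "\<lambda>c. ball c d"] d(1) by force
  have "\<forall>\<^sub>F s in sequentially. \<forall>c\<in>k. dist (F s c) (G c) < e / 3"
  proof (intro eventually_ball_finite[OF k(1)] ballI)
    fix c assume "c \<in> k"
    then have "c \<in> K" using k(2) by auto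
    then show "\<forall>\<^sub>F s in sequentially. dist (F s c) (G c) < e / 3"
      using e by (intro tendstoD[OF lim]) auto
  qed
  then show "\<forall>\<^sub>F s in sequentially. \<forall>x\<in>K. dist (F s x) (G x) < e"
  proof eventually_elim
    case (elim s)
    show ?case
    proof
      fix x assume x: "x \<in> K"
      then obtain c where c: "c \<in> k" "dist c x < d" using k(3) by auto
      then have cK: "c \<in> K" using k(2) by auto
      have "L' * dist x c < e / 3"
        using mult_strict_left_mono[OF c(2) L'(1)] d(2) by (simp add: dist_commute)
      then have "dist (F s x) (F s c) < e / 3" "dist (G x) (G c) < e / 3"
        using lip'[OF x cK, of s] lipG[OF x cK] by linarith+
      moreover have "dist (F s c) (G c) < e / 3" using elim c(1) by blast
      moreover have "dist (F s x) (G x) \<le> dist (F s x) (F s c) + dist (F s c) (G c) + dist (G x) (G c)"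
        by (metis add.commute add_left_mono dist_commute dist_triangle dist_triangle_le)
      ultimately show "dist (F s x) (G x) < e" by linarith
    qed
  qed
qed

lemma gderiv_has_derivative:
  "GDERIV V z :> d \<Longrightarrow> (V has_derivative (\<lambda>k. k \<bullet> d)) (at z within S)"
  by (simp add: gderiv_def has_derivative_at_withinI)

text \<open>Mean value inequality for \<open>V z - z \<bullet> D a\<close> on the segment: its
  gradient \<open>D z - D a\<close> is there at most \<open>L * norm (b - a)\<close> in
  norm.\<close>

lemma gderiv_taylor_bound:
  fixes V :: "'a::real_inner \<Rightarrow> real"
  assumes V: "\<And>z. GDERIV V z :> D z"
    and S: "convex S" "a \<in> S" "b \<in> S"
    and lip: "\<And>x y. x \<in> S \<Longrightarrow> y \<in> S \<Longrightarrow> norm (D x - D y) \<le> L * norm (x - y)"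
    and L: "0 \<le> L"
  shows "\<bar>V b - V a - (b - a) \<bullet> D a\<bar> \<le> L * (norm (b - a))\<^sup>2"
proof -
  have "norm ((\<lambda>z. V z - z \<bullet> D a) b - (\<lambda>z. V z - z \<bullet> D a) a) \<le> (L * norm (b - a)) * norm (b - a)"
  proof (rule differentiable_bound[where S = "closed_segment a b" and f' = "\<lambda>z k. k \<bullet> D z - k \<bullet> D a"])
    fix z assume z: "z \<in> closed_segment a b"
    show "((\<lambda>z. V z - z \<bullet> D a) has_derivative (\<lambda>k. k \<bullet> D z - k \<bullet> D a)) (at z within closed_segment a b)"
      by (rule has_derivative_diff[OF gderiv_has_derivative[OF V]]) (auto intro!: derivative_eq_intros)
    have "z \<in> S" using z S closed_segment_subset by blast
    then have "norm (D z - D a) \<le> L * norm (z - a)" using S by (intro lip)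
    also have "\<dots> \<le> L * norm (b - a)"
      using segment_bound1[OF z] L by (intro mult_left_mono)
    finally have "norm (D z - D a) \<le> L * norm (b - a)" .
    then show "onorm (\<lambda>k. k \<bullet> D z - k \<bullet> D a) \<le> L * norm (b - a)"
      by (intro onorm_bound)
         (use L in \<open>auto simp flip: inner_diff_right intro: order_trans[OF Cauchy_Schwarz_ineq2]
            simp: mult.commute mult_left_mono\<close>)
  qed auto
  then show ?thesis by (simp add: inner_diff_left power2_eq_square algebra_simps)
qed

lemma continuous_on_cballs_imp_UNIV:
  fixes E :: "'a::euclidean_space \<Rightarrow> 'b::topological_space"
  assumes "\<And>r. continuous_on (cball 0 r) E"
  shows "continuous_on UNIV E"
proof (intro continuous_at_imp_continuous_on ballI)
  fix z :: 'a
  have "z \<in> interior (cball 0 (norm z + 1))" by simp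
  with assms show "isCont E z" by (rule continuous_on_interior)
qed

text \<open>Equi-Lipschitz gradients make the difference quotients of \<open>v s\<close> approximate the derivatives
  uniformly in \<open>s\<close>, and for a fixed step the quotients converge.\<close>

lemma tendsto_gradients:
  fixes v :: "nat \<Rightarrow> 'a::euclidean_space \<Rightarrow> real"
  assumes v: "\<And>s z. GDERIV (v s) z :> D s z"
    and lip: "\<And>r. \<exists>L. \<forall>s. \<forall>x\<in>cball 0 r. \<forall>y\<in>cball 0 r. norm (D s x - D s y) \<le> L * norm (x - y)"
    and lim: "\<And>z. (\<lambda>s. v s z) \<longlonglongrightarrow> w z"
  shows "convergent (\<lambda>s. D s z)"
proof -
  have "convergent (\<lambda>s. D s z \<bullet> i)" if i: "i \<in> Basis" for i
  proof (rule real_Cauchy_convergent, rule CauchyI)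
    fix e :: real assume e: "0 < e"
    obtain L0 where L0: "\<And>s x y. x \<in> cball 0 (norm z + 1) \<Longrightarrow> y \<in> cball 0 (norm z + 1) \<Longrightarrow>
        norm (D s x - D s y) \<le> L0 * norm (x - y)" using lip by metis
    define L where "L = \<bar>L0\<bar> + 1"
    have L: "0 < L" by (simp add: L_def)
    have lipL: "norm (D s x - D s y) \<le> L * norm (x - y)"
      if "x \<in> cball 0 (norm z + 1)" "y \<in> cball 0 (norm z + 1)" for s x y
    proof -
      have "L0 * norm (x - y) \<le> L * norm (x - y)" by (intro mult_right_mono) (auto simp: L_def)
      with L0[OF that, of s] show ?thesis by linarith
    qed
    \<comment> \<open>The bound by 1 keeps \<open>z + t *\<^sub>R i\<close> in the ball where the
      Lipschitz estimate holds. The other bound makes the Taylor error at most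
      \<open>t * (e / 4)\<close>, so that two Taylor errors and one Cauchy error stay below
      \<open>t * e\<close>.\<close>
    define t where "t = min 1 (e / (4 * L))"
    have t: "0 < t" "t \<le> 1" "L * t \<le> e / 4" using L e by (auto simp: t_def min_def field_simps)
    define b where "b = z + t *\<^sub>R i"
    have b: "norm (b - z) = t" using i t by (simp add: b_def)
    have "norm b \<le> norm z + norm (b - z)" by (rule norm_triangle_sub)
    then have bin: "b \<in> cball 0 (norm z + 1)" using b t by simp
    have taylor: "\<bar>v s b - v s z - t * (D s z \<bullet> i)\<bar> \<le> t * (e / 4)" for s
    proof -
      have "\<bar>v s b - v s z - (b - z) \<bullet> D s z\<bar> \<le> L * (norm (b - z))\<^sup>2"
        using L by (intro gderiv_taylor_bound[OF v convex_cball _ bin lipL]) auto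
      also have "\<dots> = t * (L * t)" by (simp add: b power2_eq_square)
      also have "\<dots> \<le> t * (e / 4)" using t by (intro mult_left_mono) auto
      finally show ?thesis by (simp add: b_def inner_commute)
    qed
    have "Cauchy (\<lambda>s. v s b - v s z)"
      by (intro LIMSEQ_imp_Cauchy[OF tendsto_diff[OF lim lim]])
    moreover have "0 < t * (e / 4)" using t e by simp
    ultimately obtain N where N: "\<And>m n. N \<le> m \<Longrightarrow> N \<le> n \<Longrightarrow>
        norm ((v m b - v m z) - (v n b - v n z)) < t * (e / 4)"
      using CauchyD by blast
    show "\<exists>N. \<forall>m\<ge>N. \<forall>n\<ge>N. norm (D m z \<bullet> i - D n z \<bullet> i) < e"
    proof (intro exI[of _ N] allI impI)
      fix m n assume mn: "N \<le> m" "N \<le> n"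
      have "\<bar>t * (D m z \<bullet> i) - t * (D n z \<bullet> i)\<bar> < 3 * (t * (e / 4))"
        using taylor[of m] taylor[of n] N[OF mn] by (simp only: real_norm_def abs_less_iff abs_le_iff) linarith
      also have "\<dots> \<le> t * e" using t e by simp
      finally have "t * \<bar>D m z \<bullet> i - D n z \<bullet> i\<bar> < t * e"
        using t(1) by (simp add: abs_mult flip: right_diff_distrib)
      then show "norm (D m z \<bullet> i - D n z \<bullet> i) < e" using t(1) by simp
    qed
  qed
  then obtain l where l: "\<And>i. i \<in> Basis \<Longrightarrow> (\<lambda>s. D s z \<bullet> i) \<longlonglongrightarrow> l i"
    unfolding convergent_def by metis
  have "(\<lambda>s. \<Sum>i\<in>Basis. (D s z \<bullet> i) *\<^sub>R i) \<longlonglongrightarrow> (\<Sum>i\<in>Basis. l i *\<^sub>R i)"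
    by (intro tendsto_sum tendsto_scaleR l tendsto_const)
  then show ?thesis by (auto simp: euclidean_representation convergent_def)
qed

text \<open>The gradients converge locally uniformly by their Lipschitz bounds, and so do the
  values, with the gradient bound as Lipschitz constant. Termwise differentiation then makes the
  limit of the gradients the gradient of the limit.\<close>

lemma C1_limit_of_equi_lipschitz_gradients:
  fixes v :: "nat \<Rightarrow> 'a::euclidean_space \<Rightarrow> real"
  assumes v: "\<And>s z. GDERIV (v s) z :> D s z"
    and bound: "\<And>r. \<exists>B. \<forall>s. \<forall>x\<in>cball 0 r. norm (D s x) \<le> B"
    and lip: "\<And>r. \<exists>L. \<forall>s. \<forall>x\<in>cball 0 r. \<forall>y\<in>cball 0 r. norm (D s x - D s y) \<le> L * norm (x - y)"
    and lim: "\<And>z. (\<lambda>s. v s z) \<longlonglongrightarrow> w z"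
  obtains E where "\<And>z. GDERIV w z :> E z" "continuous_on UNIV E"
    "\<And>r. uniform_limit (cball 0 r) v w sequentially"
    "\<And>r. uniform_limit (cball 0 r) D E sequentially"
proof -
  obtain E where E: "\<And>z. (\<lambda>s. D s z) \<longlonglongrightarrow> E z"
    using tendsto_gradients[OF v lip lim] unfolding convergent_def by metis
  have unifD: "uniform_limit (cball 0 r) D E sequentially" for r
  proof -
    obtain L where "\<And>s x y. x \<in> cball 0 r \<Longrightarrow> y \<in> cball 0 r \<Longrightarrow> norm (D s x - D s y) \<le> L * norm (x - y)"
      using lip by metis
    with E show ?thesis by (intro uniform_limit_equi_lipschitz[OF compact_cball]) (auto simp: dist_norm)
  qed
  have unifv: "uniform_limit (cball 0 r) v w sequentially" for r
  proof -
    obtain B where B: "\<And>s x. x \<in> cball 0 r \<Longrightarrow> norm (D s x) \<le> B"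
      using bound by metis
    have "dist (v s x) (v s y) \<le> B * dist x y" if "x \<in> cball 0 r" "y \<in> cball 0 r" for s x y
      unfolding dist_norm
    proof (rule differentiable_bound[OF convex_cball gderiv_has_derivative[OF v] _ that])
      fix z assume z: "z \<in> cball (0::'a) r"
      show "onorm (\<lambda>k. k \<bullet> D s z) \<le> B"
      proof (rule onorm_bound)
        show "0 \<le> B" using B[OF z] norm_ge_zero order_trans by blast
        show "norm (k \<bullet> D s z) \<le> B * norm k" for k
          using Cauchy_Schwarz_ineq2[of k "D s z"] mult_left_mono[OF B[OF z, of s] norm_ge_zero[of k]]
          by (simp add: mult.commute)
      qed
    qed
    with lim show ?thesis by (intro uniform_limit_equi_lipschitz[OF compact_cball])
  qed
  have contD: "continuous_on (cball 0 r) (D s)" for r s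
  proof -
    obtain L where "\<And>x y. x \<in> cball 0 r \<Longrightarrow> y \<in> cball 0 r \<Longrightarrow> norm (D s x - D s y) \<le> L * norm (x - y)"
      using lip by metis
    then have "norm (D s x - D s y) \<le> \<bar>L\<bar> * norm (x - y)" if "x \<in> cball 0 r" "y \<in> cball 0 r" for x y
      using that mult_right_mono[OF abs_ge_self norm_ge_zero, of L "x - y"] by (meson order_trans)
    then have "\<bar>L\<bar>-lipschitz_on (cball 0 r) (D s)"
      by (intro lipschitz_onI) (auto simp: dist_norm)
    then show ?thesis by (rule lipschitz_on_continuous_on)
  qed
  have "continuous_on (cball 0 r) E" for r
    by (rule uniform_limit_theorem[OF _ unifD]) (auto simp: contD)
  then have contE: "continuous_on UNIV E" by (rule continuous_on_cballs_imp_UNIV)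
  have derE: "GDERIV w z :> E z" for z
  proof -
    let ?S = "cball (0::'a) (norm z + 1)"
    \<comment> \<open>Termwise differentiation supplies some limit function \<open>q\<close>;
      uniqueness of pointwise limits identifies it with \<open>w\<close> on the ball.\<close>
    have "\<exists>q. \<forall>x\<in>?S. (\<lambda>s. v s x) \<longlonglongrightarrow> q x \<and> (q has_derivative (\<lambda>k. k \<bullet> E x)) (at x within ?S)"
    proof (rule has_derivative_sequence[OF convex_cball gderiv_has_derivative[OF v] _ _ lim])
      fix e :: real assume e: "0 < e"
      show "\<forall>\<^sub>F s in sequentially. \<forall>x\<in>?S. \<forall>k. norm (k \<bullet> D s x - k \<bullet> E x) \<le> e * norm k"
        using uniform_limitD[OF unifD[of "norm z + 1"] e]
      proof eventually_elim
        case (elim s)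
        show ?case
        proof (intro ballI allI)
          fix x k :: 'a assume "x \<in> ?S"
          then have "norm (D s x - E x) \<le> e" using elim by (force simp: dist_norm)
          then have "norm k * norm (D s x - E x) \<le> norm k * e" by (intro mult_left_mono) auto
          then show "norm (k \<bullet> D s x - k \<bullet> E x) \<le> e * norm k"
            using Cauchy_Schwarz_ineq2[of k "D s x - E x"] by (simp add: inner_diff_right mult.commute)
        qed
      qed
    next
      show "z \<in> ?S" by simp
    qed
    then obtain q where q: "\<And>x. x \<in> ?S \<Longrightarrow> (\<lambda>s. v s x) \<longlonglongrightarrow> q x"
        "\<And>x. x \<in> ?S \<Longrightarrow> (q has_derivative (\<lambda>k. k \<bullet> E x)) (at x within ?S)" by blast
    have "q x = w x" if "x \<in> ?S" for x using LIMSEQ_unique[OF q(1)[OF that] lim] .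
    then have "(w has_derivative (\<lambda>k. k \<bullet> E z)) (at z within ?S)"
      using q(2)[of z] by (intro has_derivative_transform[of z ?S w q]) auto
    moreover have "z \<in> interior ?S" by simp
    ultimately show ?thesis unfolding gderiv_def using at_within_interior by metis
  qed
  show thesis by (rule that[of E]) (fact derE contE unifv unifD)+
qed

section \<open>Convergence in the norms of \<open>C^0\<close> and \<open>C^1\<close>\<close>

lemma C0_norm_tendsto_0:
  assumes "uniform_limit K F G sequentially"
  shows "(\<lambda>s. C0_norm K (\<lambda>x. F s x - G x)) \<longlonglongrightarrow> 0"
proof (cases "K = {}")
  case False
  show ?thesis
  proof (rule tendstoI)
    fix e :: real assume e: "0 < e"
    \<comment> \<open>Passing to the supremum loses strictness, so the pointwise estimate is taken
      with \<open>e / 2\<close>.\<close>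
    from uniform_limitD[OF assms half_gt_zero[OF e]]
    show "\<forall>\<^sub>F s in sequentially. dist (C0_norm K (\<lambda>x. F s x - G x)) 0 < e"
    proof eventually_elim
      case (elim s)
      then have le: "norm (F s x - G x) \<le> e / 2" if "x \<in> K" for x
        using that by (force simp: dist_norm)
      then have "(SUP x\<in>K. norm (F s x - G x)) \<le> e / 2" by (rule cSUP_least[OF False])
      moreover obtain x where "x \<in> K" using False by blast
      then have "0 \<le> (SUP x\<in>K. norm (F s x - G x))"
        using le by (intro order_trans[OF norm_ge_zero cSUP_upper[of x]] bdd_aboveI2)
      ultimately show ?case using e False by (simp add: C0_norm_def)
    qed
  qed
qed (simp add: C0_norm_def)

lemma C1_norm_tendsto_0:
  fixes v :: "nat \<Rightarrow> real^'n \<Rightarrow> real"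
  assumes v: "\<And>s z. GDERIV (v s) z :> D s z" and w: "\<And>z. GDERIV w z :> E z"
    and "uniform_limit K v w sequentially" "uniform_limit K D E sequentially"
  shows "(\<lambda>s. C1_norm K (\<lambda>x. v s x - w x)) \<longlonglongrightarrow> 0"
proof -
  have "grad (\<lambda>x. v s x - w x) = (\<lambda>x. D s x - E x)" for s
    by (intro ext grad_eqI GDERIV_diff v w)
  then show ?thesis
    unfolding C1_norm_def
    using tendsto_add[OF C0_norm_tendsto_0[OF assms(3)] C0_norm_tendsto_0[OF assms(4)]] by simp
qed

text \<open>\<open>frechet_derivative w (at x) e\<close> is \<open>e \<bullet> grad w x\<close>, and
  letting \<open>e\<close> run through the basis recovers the gradient from these directional
  derivatives.\<close>

lemma C_diff_1_iff:
  fixes w :: "real^'n \<Rightarrow> real"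
  shows "C_diff 1 w \<longleftrightarrow> (\<forall>x. w differentiable (at x)) \<and> continuous_on UNIV (grad w)"
proof -
  have fd: "frechet_derivative w (at x) e = e \<bullet> grad w x" if "w differentiable (at x)" for x e
    using frechet_derivative_at[OF grad_works[OF that, unfolded gderiv_def]] by metis
  have "continuous_on UNIV (\<lambda>x. grad w x) \<longleftrightarrow> (\<forall>e. continuous_on UNIV (\<lambda>x. e \<bullet> grad w x))"
  proof
    assume *: "\<forall>e. continuous_on UNIV (\<lambda>x. e \<bullet> grad w x)"
    have "continuous_on UNIV (\<lambda>x. \<Sum>i\<in>Basis. (i \<bullet> grad w x) *\<^sub>R i)"
      using * by (intro continuous_on_sum continuous_on_scaleR continuous_on_const) blast
    then show "continuous_on UNIV (\<lambda>x. grad w x)"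
      by (simp add: inner_commute[of _ "grad w _"] euclidean_representation)
  qed (auto intro!: continuous_intros)
  then show ?thesis by (auto simp: fd)
qed

lemma C_diff_1_D:
  fixes w :: "real^'n \<Rightarrow> real"
  assumes "C_diff 1 w"
  shows "GDERIV w x :> grad w x" and "continuous_on UNIV (grad w)"
  using assms unfolding C_diff_1_iff by (auto intro: grad_works)

lemma C_diff_1_I:
  fixes w :: "real^'n \<Rightarrow> real"
  assumes "\<And>x. GDERIV w x :> E x" "continuous_on UNIV E"
  shows "C_diff 1 w"
proof -
  have "grad w = E" using assms(1) by (intro ext grad_eqI)
  moreover have "w differentiable (at x)" for x
    using assms(1)[of x] unfolding gderiv_def by (rule differentiableI)
  ultimately show ?thesis using assms(2) unfolding C_diff_1_iff by simp
qed

section \<open>Continuity of smooth data and of matrix operations\<close>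

lemma C_infinity_imp_continuous_on: "C_infinity w \<Longrightarrow> continuous_on S w"
  unfolding C_infinity_def by (metis C_diff.simps(1) continuous_on_subset subset_UNIV)

lemma bounded_bilinear_matrix_vector_mult:
  "bounded_bilinear ((*v) :: real^'n^'m \<Rightarrow> real^'n \<Rightarrow> real^'m)"
  unfolding bilinear_conv_bounded_bilinear[symmetric] bilinear_def
  by (auto intro!: linearI simp: matrix_vector_mult_add_rdistrib vec_eq_iff matrix_vector_mult_def
      sum_distrib_left sum.distrib algebra_simps)

lemma continuous_on_transpose:
  fixes G :: "'a::topological_space \<Rightarrow> real^'m^'n"
  assumes "continuous_on S G"
  shows "continuous_on S (\<lambda>x. transpose (G x))"
  unfolding transpose_def by (intro continuous_intros assms)

section \<open>Policy evaluation and improvement\<close>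

locale control_problem =
  fixes f :: "real^'n \<Rightarrow> real^'n"
    and g :: "real^'n \<Rightarrow> real^'m^'n"
    and h :: "real^'n \<Rightarrow> real"
    and R :: "real^'m^'m"
  assumes data: "data_assumption f g h R"
begin

definition running_cost :: "real^'n \<Rightarrow> real^'m \<Rightarrow> real" where
  "running_cost z c = h z + c \<bullet> (R *v c)"

text \<open>The minimizer over \<open>c\<close> of
  \<open>(f z + g z *v c) \<bullet> D z + running_cost z c\<close>, as
  \<open>hamiltonian_complete_square\<close> shows. Applied to \<open>grad (v s)\<close> it is the
  policy improvement step.\<close>

definition greedy :: "(real^'n \<Rightarrow> real^'n) \<Rightarrow> real^'n \<Rightarrow> real^'m" where
  "greedy D z = - (1/2) *\<^sub>R (matrix_inv R *v (transpose (g z) *v D z))"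

text \<open>The property that the iteration passes from each feedback to the next. A continuous
  feedback may have several trajectories from a point; one convergent trajectory is enough to
  evaluate a cost.\<close>

definition stabilizing :: "(real^'n \<Rightarrow> real^'m) \<Rightarrow> bool" where
  "stabilizing u \<longleftrightarrow> continuous_on UNIV u \<and>
     (\<forall>x. \<exists>y. closed_loop f g u UNIV x y \<and> (y \<longlongrightarrow> 0) at_top)"

text \<open>Generalized Hamilton-Jacobi-Bellman equation, linear in \<open>V\<close> for a fixed
  feedback; for \<open>u = greedy D\<close> it becomes the nonlinear Hamilton-Jacobi-Bellman
  equation. The gradient is a separate argument so that a limit of gradients can be inserted
  directly.\<close>

definition GHJB :: "(real^'n \<Rightarrow> real^'m) \<Rightarrow> (real^'n \<Rightarrow> real) \<Rightarrow> (real^'n \<Rightarrow> real^'n) \<Rightarrow> bool" where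
  "GHJB u V D \<longleftrightarrow> (\<forall>z. GDERIV V z :> D z) \<and> continuous_on UNIV D \<and> V 0 = 0 \<and>
     (\<forall>z. (f z + g z *v u z) \<bullet> D z + running_cost z (u z) = 0)"

lemma GHJB_D:
  assumes "GHJB u V D"
  shows "GDERIV V z :> D z" "continuous_on UNIV D" "V 0 = 0"
    "(f z + g z *v u z) \<bullet> D z + running_cost z (u z) = 0"
  using assms unfolding GHJB_def by blast+

lemma R_pos: "z \<noteq> 0 \<Longrightarrow> 0 < z \<bullet> (R *v z)" and h_pos: "x \<noteq> 0 \<Longrightarrow> 0 < h x" and h_0: "h 0 = 0"
  using data unfolding data_assumption_def by auto

lemma R_nonneg: "0 \<le> z \<bullet> (R *v z)"
  using R_pos[of z] by (cases "z = 0") auto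

lemma h_nonneg: "0 \<le> h x"
  using h_pos[of x] h_0 by (cases "x = 0") auto

lemma running_cost_nonneg: "0 \<le> running_cost z c"
  unfolding running_cost_def by (intro add_nonneg_nonneg h_nonneg R_nonneg)

lemma R_symmetric: "a \<bullet> (R *v b) = b \<bullet> (R *v a)"
proof -
  have "a \<bullet> (R *v b) = (a v* R) \<bullet> b" by (rule dot_lmul_matrix[symmetric])
  also have "a v* R = transpose R *v a" by simp
  also have "transpose R = R" using data unfolding data_assumption_def by blast
  finally show ?thesis by (simp add: inner_commute)
qed

lemma R_matrix_inv: "R *v (matrix_inv R *v z) = z"
proof -
  have "inj ((*v) R)"
  proof (rule injI)
    fix a b assume "R *v a = R *v b"
    then have "(a - b) \<bullet> (R *v (a - b)) = 0" by (simp add: matrix_vector_mult_diff_distrib)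
    then show "a = b" using R_pos[of "a - b"] by force
  qed
  \<comment> \<open>\<open>matrix_inv\<close> is a choice term, which is informative only once a
    two-sided inverse is known to exist.\<close>
  then have "\<exists>A. R ** A = mat 1 \<and> A ** R = mat 1"
    by (metis invertible_def invertible_left_inverse matrix_left_invertible_injective)
  then have "R ** matrix_inv R = mat 1" unfolding matrix_inv_def by (rule someI2_ex) blast
  then show ?thesis by (simp add: matrix_vector_mul_assoc)
qed

lemma continuous_f: "continuous_on S f" and continuous_g: "continuous_on S g"
  and continuous_h: "continuous_on S h"
  using data unfolding data_assumption_def by (auto intro: C_infinity_imp_continuous_on)

lemma continuous_on_greedy: "continuous_on S D \<Longrightarrow> continuous_on S (greedy D)"
  unfolding greedy_def
  by (intro continuous_intros bounded_bilinear.continuous_on[OF bounded_bilinear_matrix_vector_mult]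
      continuous_on_transpose continuous_g)

lemma continuous_on_running_cost:
  assumes "continuous_on S y" "continuous_on S c"
  shows "continuous_on S (\<lambda>t. running_cost (y t) (c t))"
  unfolding running_cost_def
  by (intro continuous_intros continuous_on_compose2[OF continuous_h assms(1) subset_UNIV]
      bounded_bilinear.continuous_on[OF bounded_bilinear_matrix_vector_mult] assms)

lemma continuous_on_dynamics:
  assumes "continuous_on S y" "continuous_on S c"
  shows "continuous_on S (\<lambda>t. f (y t) + g (y t) *v c t)"
  by (intro continuous_intros continuous_on_compose2[OF continuous_f assms(1) subset_UNIV]
      continuous_on_compose2[OF continuous_g assms(1) subset_UNIV]
      bounded_bilinear.continuous_on[OF bounded_bilinear_matrix_vector_mult] assms)

text \<open>\<open>R *v greedy D z\<close> is \<open>-1/2\<close> times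
  \<open>transpose (g z) *v D z\<close>, so the term linear in \<open>c\<close> equals
  \<open>- 2 * (c \<bullet> (R *v greedy D z))\<close>. The Hamiltonian is thus a quadratic in
  \<open>c\<close> with vertex \<open>greedy D z\<close>; symmetry of \<open>R\<close> merges the
  cross terms.\<close>

lemma hamiltonian_complete_square:
  "(f z + g z *v c) \<bullet> D z + running_cost z c
     = f z \<bullet> D z + h z - greedy D z \<bullet> (R *v greedy D z)
       + (c - greedy D z) \<bullet> (R *v (c - greedy D z))"
proof -
  let ?p = "transpose (g z) *v D z"
  have R_greedy: "R *v greedy D z = - (1/2) *\<^sub>R ?p"
    unfolding greedy_def by (simp only: matrix_vector_mult_scaleR R_matrix_inv)
  have "(g z *v c) \<bullet> D z = c \<bullet> ?p"
    by (metis dot_lmul_matrix inner_commute transpose_matrix_vector)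
  also have "\<dots> = - 2 * (c \<bullet> (R *v greedy D z))"
    unfolding R_greedy by simp
  finally have "(g z *v c) \<bullet> D z = - 2 * (c \<bullet> (R *v greedy D z))" .
  moreover have "greedy D z \<bullet> (R *v c) = c \<bullet> (R *v greedy D z)" by (rule R_symmetric)
  ultimately show ?thesis
    unfolding running_cost_def
    by (simp add: matrix_vector_mult_diff_distrib inner_diff_left inner_diff_right inner_add_left)
qed

text \<open>The Hamiltonian vanishes at \<open>u z\<close>, and \<open>greedy D z\<close> minimizes
  it.\<close>

lemma GHJB_improved:
  assumes "GHJB u V D"
  shows "(f z + g z *v greedy D z) \<bullet> D z + running_cost z (greedy D z) \<le> 0"
proof -
  have "(f z + g z *v u z) \<bullet> D z + running_cost z (u z) = 0" by (rule GHJB_D[OF assms])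
  moreover have "(f z + g z *v greedy D z) \<bullet> D z + running_cost z (greedy D z)
      = f z \<bullet> D z + h z - greedy D z \<bullet> (R *v greedy D z)"
    using hamiltonian_complete_square[of z "greedy D z" D] by simp
  ultimately show ?thesis
    using hamiltonian_complete_square[of z "u z" D] R_nonneg[of "u z - greedy D z"] by linarith
qed

section \<open>Closed-loop trajectories and their cost\<close>

lemma closed_loop_derivative:
  assumes "closed_loop f g u UNIV x y" "0 \<le> t"
  shows "(y has_vector_derivative f (y t) + g (y t) *v u (y t)) (at t within {0..})"
  using assms unfolding closed_loop_def by blast

lemma closed_loop_continuous:
  assumes "closed_loop f g u UNIV x y"
  shows "continuous_on {0..} y"
  using closed_loop_derivative[OF assms] by (rule continuous_on_trajectory)

lemma closed_loop_running_cost_continuous: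
  assumes "closed_loop f g u UNIV x y" "continuous_on UNIV u"
  shows "continuous_on {0..} (\<lambda>t. running_cost (y t) (u (y t)))"
  using closed_loop_continuous[OF assms(1)]
  by (intro continuous_on_running_cost continuous_on_compose2[OF assms(2)]) auto

lemma closed_loop_shift:
  assumes "closed_loop f g u UNIV x y" "0 \<le> T"
  shows "closed_loop f g u UNIV (y T) (\<lambda>t. y (t + T))"
  unfolding closed_loop_def
proof (intro conjI allI impI)
  fix t :: real assume t: "0 \<le> t"
  have "(y has_vector_derivative f (y (t + T)) + g (y (t + T)) *v u (y (t + T))) (at (t + T) within (\<lambda>t. t + T) ` {0..})"
    using assms t by (intro has_vector_derivative_within_subset[OF closed_loop_derivative[OF assms(1)]]) auto
  moreover have "((\<lambda>t. t + T) has_vector_derivative 1) (at t within {0..})"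
    by (auto intro!: derivative_eq_intros)
  ultimately
  show "((\<lambda>t. y (t + T)) has_vector_derivative f (y (t + T)) + g (y (t + T)) *v u (y (t + T))) (at t within {0..})"
    using vector_diff_chain_within by (fastforce simp: o_def)
qed auto

lemma cost_eq_iff:
  assumes "closed_loop f g u UNIV x y" "continuous_on UNIV u"
  shows "cost h R y (\<lambda>t. u (y t)) = ereal r \<longleftrightarrow>
    ((\<lambda>T. integral {0..T} (\<lambda>t. running_cost (y t) (u (y t)))) \<longlongrightarrow> r) at_top"
  unfolding cost_def running_cost_def[symmetric]
  by (intro nn_integral_eq_limit closed_loop_running_cost_continuous[OF assms] running_cost_nonneg)

lemma optimal_value_nonneg: "0 \<le> optimal_value f g h R x"
  unfolding optimal_value_def by (rule Inf_greatest) (auto simp: cost_def)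

text \<open>The infimum ranges over essentially bounded controls, so the feedback signal has to be
  shown to be one. It is bounded on an initial interval by compactness, and afterwards because
  \<open>y\<close> tends to 0 and \<open>u\<close> is continuous there.\<close>

lemma optimal_value_le_cost:
  assumes cl: "closed_loop f g u UNIV x y" and u: "continuous_on UNIV u" and lim: "(y \<longlongrightarrow> 0) at_top"
  shows "optimal_value f g h R x \<le> cost h R y (\<lambda>t. u (y t))"
proof -
  have y: "continuous_on {0..} y" by (rule closed_loop_continuous[OF cl])
  have uy: "continuous_on {0..} (\<lambda>t. u (y t))" by (rule continuous_on_compose2[OF u y]) auto
  have "((\<lambda>t. u (y t)) \<longlongrightarrow> u 0) at_top"
    using u lim by (intro isCont_tendsto_compose[of 0 u]) (auto simp: continuous_on_eq_continuous_at)
  then obtain T where T: "\<And>t. T \<le> t \<Longrightarrow> dist (u (y t)) (u 0) < 1"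
    using tendstoD[of _ "u 0" at_top 1] by (force simp: eventually_at_top_linorder)
  have "compact ((\<lambda>t. u (y t)) ` {0..T})"
    by (intro compact_continuous_image continuous_on_subset[OF uy]) auto
  then obtain B where B: "\<And>t. t \<in> {0..T} \<Longrightarrow> norm (u (y t)) \<le> B"
    using compact_imp_bounded by (force simp: bounded_iff)
  have "norm (u (y t)) \<le> max B (norm (u 0) + 1)" if "0 \<le> t" for t
  proof (cases "t \<le> T")
    case False
    then have "norm (u (y t) - u 0) < 1" using T[of t] by (simp add: dist_norm)
    then show ?thesis using norm_triangle_sub[of "u (y t)" "u 0"] by linarith
  qed (use B[of t] that in auto)
  then have "AE t in lebesgue_on {0..}. norm (u (y t)) \<le> max B (norm (u 0) + 1)"
    by (intro AE_I2) (auto simp: space_restrict_space)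
  moreover have "(\<lambda>t. u (y t)) \<in> borel_measurable (lebesgue_on {0..})"
    by (intro continuous_imp_measurable_on_sets_lebesgue uy) auto
  ultimately have "(\<lambda>t. u (y t)) \<in> controls" unfolding controls_def by blast
  moreover have "caratheodory_solution f g (\<lambda>t. u (y t)) x y"
    unfolding caratheodory_solution_def
  proof (intro allI impI conjI)
    fix t :: real assume t: "0 \<le> t"
    have "continuous_on {0..} (\<lambda>\<tau>. f (y \<tau>) + g (y \<tau>) *v u (y \<tau>))"
      by (intro continuous_on_dynamics y uy)
    then show "(\<lambda>\<tau>. f (y \<tau>) + g (y \<tau>) *v u (y \<tau>)) absolutely_integrable_on {0..t}"
      by (intro absolutely_integrable_continuous_real) (auto intro: continuous_on_subset)
    have "((\<lambda>\<tau>. f (y \<tau>) + g (y \<tau>) *v u (y \<tau>)) has_integral (y t - y 0)) {0..t}"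
      using t by (intro fundamental_theorem_of_calculus
          has_vector_derivative_within_subset[OF closed_loop_derivative[OF cl]]) auto
    moreover have "y 0 = x" using cl by (simp add: closed_loop_def)
    ultimately show "y t = x + integral {0..t} (\<lambda>\<tau>. f (y \<tau>) + g (y \<tau>) *v u (y \<tau>))"
      by (simp add: integral_unique)
  qed
  ultimately show ?thesis unfolding optimal_value_def
    by (intro Inf_lower CollectI exI conjI) (rule refl | assumption)+
qed

section \<open>Policy evaluation through the linear equation\<close>

lemma GHJB_integral:
  assumes G: "GHJB u V D" and cl: "closed_loop f g u UNIV x y" and "0 \<le> T"
  shows "integral {0..T} (\<lambda>t. running_cost (y t) (u (y t))) = V x - V (y T)"
proof -
  have "((\<lambda>t. (f (y t) + g (y t) *v u (y t)) \<bullet> D (y t)) has_integral (V (y T) - V (y 0))) {0..T}"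
    by (rule has_integral_along, rule GHJB_D(1)[OF G], erule closed_loop_derivative[OF cl],
        rule order_refl, rule \<open>0 \<le> T\<close>)
  from has_integral_neg[OF this]
  have "((\<lambda>t. - ((f (y t) + g (y t) *v u (y t)) \<bullet> D (y t))) has_integral (V x - V (y T))) {0..T}"
    using cl by (simp add: closed_loop_def)
  moreover have "- ((f z + g z *v u z) \<bullet> D z) = running_cost z (u z)" for z
    using GHJB_D(4)[OF G, of z] by linarith
  ultimately show ?thesis by (simp add: integral_unique)
qed

text \<open>The cost accumulated up to \<open>T\<close> is \<open>V x - V (y T)\<close>, and the
  last term tends to \<open>V 0 = 0\<close>.\<close>

lemma GHJB_integral_tendsto:
  assumes G: "GHJB u V D" and cl: "closed_loop f g u UNIV x y" and lim: "(y \<longlongrightarrow> 0) at_top"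
  shows "((\<lambda>T. integral {0..T} (\<lambda>t. running_cost (y t) (u (y t)))) \<longlongrightarrow> V x) at_top"
proof -
  have "isCont V 0"
    by (rule has_derivative_continuous[OF gderiv_has_derivative[OF GHJB_D(1)[OF G]]])
  then have "((\<lambda>T. V (y T)) \<longlongrightarrow> V 0) at_top" using lim by (rule isCont_tendsto_compose)
  then have "((\<lambda>T. V x - V (y T)) \<longlongrightarrow> V x - V 0) at_top" by (intro tendsto_intros)
  with GHJB_D(3)[OF G] have "((\<lambda>T. V x - V (y T)) \<longlongrightarrow> V x) at_top" by simp
  moreover have "\<forall>\<^sub>F T in at_top. V x - V (y T) = integral {0..T} (\<lambda>t. running_cost (y t) (u (y t)))"
    using eventually_ge_at_top[of 0] by eventually_elim (rule GHJB_integral[OF G cl, symmetric])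
  ultimately show ?thesis by (rule Lim_transform_eventually)
qed

text \<open>A convergent trajectory under \<open>u\<close> has cost exactly \<open>V x\<close> and
  competes in the infimum.\<close>

lemma optimal_value_le_GHJB:
  assumes G: "GHJB u V D" and u: "stabilizing u"
  shows "optimal_value f g h R x \<le> ereal (V x)"
proof -
  obtain y where y: "closed_loop f g u UNIV x y" "(y \<longlongrightarrow> 0) at_top" and cont: "continuous_on UNIV u"
    using u unfolding stabilizing_def by blast
  have "cost h R y (\<lambda>t. u (y t)) = ereal (V x)"
    unfolding cost_eq_iff[OF y(1) cont] by (rule GHJB_integral_tendsto[OF G y])
  with optimal_value_le_cost[OF y(1) cont y(2)] show ?thesis by simp
qed

section \<open>Policy improvement by Lyapunov functions\<close>

lemma bounded_sublevel:
  assumes rad: "(optimal_value f g h R \<longlongrightarrow> \<infinity>) at_infinity"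
    and le: "\<And>z. optimal_value f g h R z \<le> ereal (V z)"
  shows "bounded {z. V z \<le> c}"
proof -
  have "\<forall>\<^sub>F z in at_infinity. ereal c < optimal_value f g h R z"
    using rad by (rule order_tendstoD) simp
  then obtain B where B: "\<And>z. B \<le> norm z \<Longrightarrow> ereal c < optimal_value f g h R z"
    unfolding eventually_at_infinity by blast
  have "norm z \<le> B" if "V z \<le> c" for z
  proof (rule ccontr)
    assume "\<not> norm z \<le> B"
    then have "ereal c < optimal_value f g h R z" by (intro B) simp
    also have "\<dots> \<le> ereal (V z)" by (rule le)
    finally have "ereal c < ereal (V z)" .
    then show False using that by simp
  qed
  then show ?thesis by (auto simp: bounded_iff)
qed

text \<open>If \<open>V\<close> vanished at \<open>z\<close>, then \<open>z\<close> would be a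
  global minimum and \<open>D z = 0\<close>; the equation would force the running cost at
  \<open>z\<close> to vanish, against \<open>h z > 0\<close>.\<close>

lemma GHJB_positive:
  assumes G: "GHJB u V D" and nonneg: "\<And>z. 0 \<le> V z" and "z \<noteq> 0"
  shows "0 < V z"
proof (rule ccontr)
  assume "\<not> 0 < V z"
  then have "V z \<le> V w" for w using nonneg[of w] by linarith
  moreover have "(V has_derivative (\<lambda>k. k \<bullet> D z)) (at z)"
    by (rule gderiv_has_derivative[OF GHJB_D(1)[OF G]])
  ultimately have "(\<lambda>k. k \<bullet> D z) = (\<lambda>k. 0)" by (intro has_derivative_local_min[of V] always_eventually allI)
  from fun_cong[OF this, of "D z"] have "D z = 0" by simp
  moreover have "(f z + g z *v u z) \<bullet> D z + running_cost z (u z) = 0" by (rule GHJB_D(4)[OF G])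
  ultimately have "running_cost z (u z) = 0" by simp
  moreover have "0 < running_cost z (u z)"
    unfolding running_cost_def using h_pos[OF \<open>z \<noteq> 0\<close>] R_nonneg by (rule add_pos_nonneg)
  ultimately show False by simp
qed

text \<open>\<open>V\<close> is a Lyapunov function for the improved feedback: positive away from 0
  by the equation, proper because it dominates the radially unbounded optimal value, and decreasing
  at least at the rate \<open>h\<close>.\<close>

lemma stabilizing_greedy:
  assumes rad: "(optimal_value f g h R \<longlongrightarrow> \<infinity>) at_infinity"
    and G: "GHJB u V D" and u: "stabilizing u"
  shows "stabilizing (greedy D)"
proof -
  note V = GHJB_D(1-3)[OF G]
  have le: "\<And>z. optimal_value f g h R z \<le> ereal (V z)" by (rule optimal_value_le_GHJB[OF G u])
  have V_nonneg: "0 \<le> V z" for z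
    using order_trans[OF optimal_value_nonneg le] by simp
  have bdd: "\<And>c. bounded {z. V z \<le> c}" by (rule bounded_sublevel[OF rad le])
  have cont: "continuous_on UNIV (greedy D)" by (rule continuous_on_greedy[OF V(2)])
  define F where "F z = f z + g z *v greedy D z" for z
  have contF: "continuous_on UNIV F" unfolding F_def
    by (intro continuous_on_dynamics continuous_on_id cont)
  have FD: "F z \<bullet> D z \<le> - h z" for z
    using GHJB_improved[OF G, of z] R_nonneg[of "greedy D z"] unfolding F_def running_cost_def by linarith
  have "F z \<bullet> D z \<le> 0" for z using FD[of z] h_nonneg[of z] by linarith
  have "\<exists>y. closed_loop f g (greedy D) UNIV x y \<and> (y \<longlongrightarrow> 0) at_top" for x
  proof -
    obtain y where y: "y 0 = x" "\<And>t. 0 \<le> t \<Longrightarrow> (y has_vector_derivative F (y t)) (at t within {0..})"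
      using lyapunov_trajectory_exists[OF V(1) bdd contF \<open>\<And>z. F z \<bullet> D z \<le> 0\<close>] by blast
    have "closed_loop f g (greedy D) UNIV x y"
      using y unfolding closed_loop_def F_def by simp
    moreover have "(y \<longlongrightarrow> 0) at_top"
      by (rule lyapunov_trajectory_tendsto[where V = V and D = D and W = h and F = F])
         (simp_all add: V GHJB_positive[OF G V_nonneg] bdd continuous_h h_pos h_0 FD y(2))
    ultimately show ?thesis by blast
  qed
  with cont show ?thesis unfolding stabilizing_def by blast
qed

text \<open>\<open>V'\<close> is the total cost of the improved feedback, and along its trajectory
  \<open>V\<close> drops at least at the rate of that running cost. As \<open>V (y T)\<close> tends
  to 0, the total is at most \<open>V x\<close>.\<close>

lemma GHJB_greedy_le:
  assumes G: "GHJB u V D" and G': "GHJB (greedy D) V' D'" and st: "stabilizing (greedy D)"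
  shows "V' x \<le> V x"
proof -
  obtain y where y: "closed_loop f g (greedy D) UNIV x y" "(y \<longlongrightarrow> 0) at_top"
    and cont: "continuous_on UNIV (greedy D)"
    using st unfolding stabilizing_def by blast
  note V = GHJB_D(1,3)[OF G]
  have "V (y T) + integral {0..T} (\<lambda>t. running_cost (y t) (greedy D (y t))) \<le> V (y 0)" if "0 \<le> T" for T
  proof (rule dissipation_inequality[where D = D and w = "\<lambda>t. f (y t) + g (y t) *v greedy D (y t)"])
    show "(f (y t) + g (y t) *v greedy D (y t)) \<bullet> D (y t) \<le> - running_cost (y t) (greedy D (y t))" for t
      using GHJB_improved[OF G, of "y t"] by linarith
  qed (use that in \<open>simp_all add: V(1) closed_loop_derivative[OF y(1)]
      closed_loop_running_cost_continuous[OF y(1) cont]\<close>)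
  moreover have "y 0 = x" using y(1) by (simp add: closed_loop_def)
  ultimately have le: "integral {0..T} (\<lambda>t. running_cost (y t) (greedy D (y t))) \<le> V x - V (y T)" if "0 \<le> T" for T
    using that by fastforce
  have "\<forall>\<^sub>F T in at_top. integral {0..T} (\<lambda>t. running_cost (y t) (greedy D (y t))) \<le> V x - V (y T)"
    using eventually_ge_at_top[of 0] by eventually_elim (rule le)
  moreover
  have "isCont V 0"
    by (rule has_derivative_continuous[OF gderiv_has_derivative[OF V(1)]])
  then have "((\<lambda>T. V (y T)) \<longlongrightarrow> V 0) at_top" using y(2) by (rule isCont_tendsto_compose)
  then have "((\<lambda>T. V x - V (y T)) \<longlongrightarrow> V x - V 0) at_top" by (intro tendsto_intros)
  ultimately have "V' x \<le> V x - V 0"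
    using tendsto_le[OF trivial_limit_at_top_linorder _ GHJB_integral_tendsto[OF G' y]] by blast
  then show ?thesis using V(2) by simp
qed

section \<open>Verification of the limit\<close>

text \<open>Under the Hamilton-Jacobi-Bellman equation the minimum of the Hamiltonian is 0, so
  completing the square leaves the squared \<open>R\<close>-norm of the deviation from
  \<open>greedy E\<close> as the only excess cost.\<close>

lemma hjb_integral:
  assumes HJB: "GHJB (greedy E) W E"
    and cl: "closed_loop f g u UNIV x y" and u: "continuous_on UNIV u" and T: "0 \<le> T"
  shows "integral {0..T} (\<lambda>t. running_cost (y t) (u (y t))) = W x - W (y T)
    + integral {0..T} (\<lambda>t. (u (y t) - greedy E (y t)) \<bullet> (R *v (u (y t) - greedy E (y t))))"
proof -
  define Q where "Q z = (u z - greedy E z) \<bullet> (R *v (u z - greedy E z))" for z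
  have contQ: "continuous_on UNIV Q"
    unfolding Q_def by (intro continuous_intros u continuous_on_greedy GHJB_D(2)[OF HJB]
        bounded_bilinear.continuous_on[OF bounded_bilinear_matrix_vector_mult])
  have contQy: "continuous_on {0..} (\<lambda>t. Q (y t))"
    by (rule continuous_on_compose2[OF contQ closed_loop_continuous[OF cl]]) simp
  have "(f z + g z *v u z) \<bullet> E z = Q z - running_cost z (u z)" for z
    using hamiltonian_complete_square[of z "u z" E] hamiltonian_complete_square[of z "greedy E z" E]
      GHJB_D(4)[OF HJB, of z] unfolding Q_def by simp
  moreover have "((\<lambda>t. (f (y t) + g (y t) *v u (y t)) \<bullet> E (y t)) has_integral (W (y T) - W (y 0))) {0..T}"
    by (rule has_integral_along, rule GHJB_D(1)[OF HJB], erule closed_loop_derivative[OF cl],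
        rule order_refl, rule T)
  ultimately have "((\<lambda>t. Q (y t) - running_cost (y t) (u (y t))) has_integral (W (y T) - W (y 0))) {0..T}"
    by simp
  moreover have "((\<lambda>t. Q (y t)) has_integral integral {0..T} (\<lambda>t. Q (y t))) {0..T}"
    by (intro integrable_integral integrable_continuous_real continuous_on_subset[OF contQy]) simp
  ultimately have "((\<lambda>t. Q (y t) - (Q (y t) - running_cost (y t) (u (y t)))) has_integral
      (integral {0..T} (\<lambda>t. Q (y t)) - (W (y T) - W (y 0)))) {0..T}"
    by (rule has_integral_diff[rotated])
  moreover have "y 0 = x" using cl by (simp add: closed_loop_def)
  ultimately show ?thesis unfolding Q_def[symmetric] by (simp add: integral_unique)
qed

text \<open>\<open>ustar\<close> is optimal from every initial state, so the tail of an optimal trajectory is optimal too.\<close>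

lemma optimal_value_along:
  assumes opt: "optimal_controller f g h R ustar"
    and fin: "\<And>z. optimal_value f g h R z = ereal (val z)"
    and cl: "closed_loop f g ustar UNIV x y" and T: "0 \<le> T"
  shows "((\<lambda>S. integral {0..S} (\<lambda>t. running_cost (y t) (ustar (y t)))) \<longlongrightarrow> val x) at_top"
    and "integral {0..T} (\<lambda>t. running_cost (y t) (ustar (y t))) = val x - val (y T)"
proof -
  have cont: "continuous_on UNIV ustar" using opt unfolding optimal_controller_def by blast
  have lim: "((\<lambda>S. integral {0..S} (\<lambda>t. running_cost (y t) (ustar (y t)))) \<longlongrightarrow> val x) at_top"
    if cl: "closed_loop f g ustar UNIV x y" for x y
  proof -
    have "cost h R y (\<lambda>t. ustar (y t)) = ereal (val x)"
      using opt cl fin unfolding optimal_controller_def by metis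
    then show ?thesis unfolding cost_eq_iff[OF cl cont] .
  qed
  show limx: "((\<lambda>S. integral {0..S} (\<lambda>t. running_cost (y t) (ustar (y t)))) \<longlongrightarrow> val x) at_top"
    by (rule lim[OF cl])
  define L where "L t = running_cost (y t) (ustar (y t))" for t
  have contL: "continuous_on {0..} L"
    unfolding L_def by (rule closed_loop_running_cost_continuous[OF cl cont])
  have tail: "((\<lambda>S. integral {0..S} (\<lambda>t. L (t + T))) \<longlongrightarrow> val (y T)) at_top"
    using lim[OF closed_loop_shift[OF cl T]] unfolding L_def .
  \<comment> \<open>The tail cost a second time, now as the total cost minus the cost up to
    \<open>T\<close>; uniqueness of limits equates it with \<open>val (y T)\<close>.\<close>
  have diff: "((\<lambda>S. integral {0..S + T} L - integral {0..T} L) \<longlongrightarrow> val x - integral {0..T} L) at_top"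
  proof (rule tendsto_diff[OF _ tendsto_const])
    have "filterlim (\<lambda>S. S + T) at_top at_top"
      using filterlim_tendsto_add_at_top[OF tendsto_const[of T] filterlim_ident] by (simp add: add.commute)
    with limx show "((\<lambda>S. integral {0..S + T} L) \<longlongrightarrow> val x) at_top"
      unfolding L_def[symmetric] by (rule filterlim_compose)
  qed
  have "\<forall>\<^sub>F S in at_top. integral {0..S + T} L - integral {0..T} L = integral {0..S} (\<lambda>t. L (t + T))"
    using eventually_ge_at_top[of 0]
  proof eventually_elim
    case (elim S)
    have "integral {0..T} L + integral {T..S + T} L = integral {0..S + T} L"
      using T elim by (intro Henstock_Kurzweil_Integration.integral_combine integrable_continuous_real
          continuous_on_subset[OF contL]) auto
    moreover have "integral {0..S} (\<lambda>t. L (t + T)) = integral {T..S + T} L"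
      using integral_shift[of 0 T S L] continuous_on_subset[OF contL] T by (simp add: o_def)
    ultimately show ?case by simp
  qed
  from tendsto_unique[OF trivial_limit_at_top_linorder tail Lim_transform_eventually[OF diff this]]
  have "val (y T) = val x - integral {0..T} L" .
  then show "integral {0..T} (\<lambda>t. running_cost (y t) (ustar (y t))) = val x - val (y T)"
    unfolding L_def by simp
qed

text \<open>Let \<open>val\<close> be the real-valued optimal value and \<open>Q\<close> the defect.
  The two descriptions of the cost of \<open>ustar\<close> up to \<open>T\<close> give \<open>val x
  - W x = val (y T) - W (y T) + integral {0..T} (\<lambda>t. Q (y t))\<close>. The first and last
  terms on the right are nonnegative and \<open>W (y T)\<close> is small at suitable times, hence
  \<open>W x \<le> val x\<close>.\<close>

lemma hjb_verification:
  assumes rad: "(optimal_value f g h R \<longlongrightarrow> \<infinity>) at_infinity"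
    and HJB: "GHJB (greedy E) W E"
    and ge: "\<And>z. optimal_value f g h R z \<le> ereal (W z)"
    and opt: "optimal_controller f g h R ustar"
  shows "optimal_value f g h R x = ereal (W x)" and "ustar x = greedy E x"
proof -
  define val where "val z = real_of_ereal (optimal_value f g h R z)" for z
  \<comment> \<open>The lower bound 0 and the real upper bound \<open>W z\<close> exclude both
    infinities.\<close>
  have fin: "optimal_value f g h R z = ereal (val z)" for z
    unfolding val_def using ge[of z] optimal_value_nonneg[of z]
    by (cases "optimal_value f g h R z") auto
  have val_nonneg: "0 \<le> val z" and val_le: "val z \<le> W z" for z
    using ge[of z] optimal_value_nonneg[of z] unfolding fin by simp_all
  have cont: "continuous_on UNIV ustar" using opt unfolding optimal_controller_def by blast
  have ex: "\<exists>y. closed_loop f g ustar UNIV x y" for x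
    using opt unfolding optimal_controller_def by blast
  define Q where "Q z = (ustar z - greedy E z) \<bullet> (R *v (ustar z - greedy E z))" for z
  have contQ: "continuous_on UNIV Q"
    unfolding Q_def by (intro continuous_intros cont continuous_on_greedy GHJB_D(2)[OF HJB]
        bounded_bilinear.continuous_on[OF bounded_bilinear_matrix_vector_mult])
  have Q_nonneg: "0 \<le> Q z" for z unfolding Q_def by (rule R_nonneg)
  have int_Q: "val x - val (y T) = W x - W (y T) + integral {0..T} (\<lambda>t. Q (y t))"
    if "closed_loop f g ustar UNIV x y" "0 \<le> T" for x y T
    using optimal_value_along(2)[OF opt fin that] hjb_integral[OF HJB that(1) cont that(2)]
    unfolding Q_def by simp
  have contQy: "continuous_on {0..} (\<lambda>t. Q (y t))" if "closed_loop f g ustar UNIV x y" for x y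
    by (rule continuous_on_compose2[OF contQ closed_loop_continuous[OF that]]) simp
  have int_Q_nonneg: "0 \<le> integral {0..T} (\<lambda>t. Q (y t))" if "closed_loop f g ustar UNIV x y" for x y T
    by (intro integral_nonneg integrable_continuous_real continuous_on_subset[OF contQy[OF that]] Q_nonneg) simp
  have "W x \<le> val x" for x
  proof (rule field_le_epsilon)
    fix e :: real assume e: "0 < e"
    obtain y where y: "closed_loop f g ustar UNIV x y" using ex by blast
    have "isCont W 0"
      by (rule has_derivative_continuous[OF gderiv_has_derivative[OF GHJB_D(1)[OF HJB]]])
    then obtain d where d: "0 < d" "\<And>z. dist z 0 < d \<Longrightarrow> dist (W z) (W 0) < e"
      using e unfolding continuous_at_eps_delta by blast
    have int_L: "integral {0..T} (\<lambda>t. running_cost (y t) (ustar (y t))) \<le> val x" if "0 \<le> T" for T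
      using optimal_value_along(2)[OF opt fin y that] val_nonneg[of "y T"] by simp
    have val_y: "val (y T) \<le> val x" if "0 \<le> T" for T
    proof -
      have "0 \<le> integral {0..T} (\<lambda>t. running_cost (y t) (ustar (y t)))"
        by (intro integral_nonneg integrable_continuous_real running_cost_nonneg
            continuous_on_subset[OF closed_loop_running_cost_continuous[OF y cont]]) simp
      then show ?thesis using optimal_value_along(2)[OF opt fin y that] by simp
    qed
    \<comment> \<open>The optimal value does not increase along \<open>y\<close>, so radial
      unboundedness confines \<open>y\<close> to a ball.\<close>
    have "bounded {z. val z \<le> val x}"
      by (rule bounded_sublevel[OF rad]) (simp add: fin)
    then obtain B where B: "\<And>z. val z \<le> val x \<Longrightarrow> norm z \<le> B" by (auto simp: bounded_iff)
    have "\<exists>T\<ge>0. norm (y T) < d"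
    proof (rule trajectory_visits_ball[where h = h])
      show "integral {0..T} (\<lambda>t. h (y t)) \<le> val x" if "0 \<le> T" for T
      proof -
        have "continuous_on {0..} (\<lambda>t. h (y t))"
          by (rule continuous_on_compose2[OF continuous_h closed_loop_continuous[OF y] subset_UNIV])
        then have "integral {0..T} (\<lambda>t. h (y t)) \<le> integral {0..T} (\<lambda>t. running_cost (y t) (ustar (y t)))"
          by (intro integral_le integrable_continuous_real
              continuous_on_subset[OF closed_loop_running_cost_continuous[OF y cont]])
             (auto intro: continuous_on_subset simp: running_cost_def R_nonneg)
        also have "\<dots> \<le> val x" by (rule int_L[OF that])
        finally show ?thesis .
      qed
      show "norm (y t) \<le> B" if "0 \<le> t" for t by (rule B[OF val_y[OF that]])
    qed (rule continuous_h closed_loop_continuous[OF y] d(1) h_pos; assumption?)+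
    then obtain T where T: "0 \<le> T" "norm (y T) < d" by blast
    have "W (y T) < e" using d(2)[of "y T"] T(2) GHJB_D(3)[OF HJB] by (simp add: dist_norm)
    moreover have "W x \<le> val x + W (y T)"
      using int_Q[OF y T(1)] int_Q_nonneg[OF y, of T] val_nonneg[of "y T"] by linarith
    ultimately show "W x \<le> val x + e" by linarith
  qed
  then have val_eq: "val z = W z" for z using val_le by (simp add: order_antisym)
  show "optimal_value f g h R x = ereal (W x)" unfolding fin val_eq ..
  obtain y where y: "closed_loop f g ustar UNIV x y" using ex by blast
  \<comment> \<open>With \<open>val = W\<close> the boundary terms cancel. A continuous nonnegative
    function with zero integral vanishes at the initial time, so \<open>Q x = 0\<close>; the horizon
    1 is arbitrary.\<close>
  have "integral {0..1} (\<lambda>t. Q (y t)) = 0"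
    using int_Q[OF y, of 1] by (simp add: val_eq)
  then have "((\<lambda>t. Q (y t)) has_integral 0) {0..1}"
    by (metis continuous_on_subset[OF contQy[OF y]] Icc_subset_Ici_iff integrable_continuous_real
        integrable_integral order_refl)
  then have "Q (y 0) = 0"
    using has_integral_0_cbox_imp_0[of 0 "1::real" "\<lambda>t. Q (y t)" 0] Q_nonneg
      continuous_on_subset[OF contQy[OF y], of "{0..1}"] by auto
  moreover have "y 0 = x" using y by (simp add: closed_loop_def)
  ultimately have "Q x = 0" by simp
  then show "ustar x = greedy E x" unfolding Q_def using R_pos[of "ustar x - greedy E x"] by force
qed

text \<open>Bilinear products preserve uniform convergence when the limits are bounded; compactness
  of \<open>K\<close> and continuity supply the bounds.\<close>

lemma uniform_limit_greedy:
  assumes D: "uniform_limit K D E sequentially" and E: "continuous_on UNIV E" and K: "compact K"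
  shows "uniform_limit K (\<lambda>s. greedy (D s)) (greedy E) sequentially"
proof -
  have bdd: "bounded (q ` K)" if "continuous_on UNIV q" for q :: "real^'n \<Rightarrow> 'z::real_normed_vector"
    by (intro compact_imp_bounded compact_continuous_image K continuous_on_subset[OF that]) simp
  have gT: "continuous_on UNIV (\<lambda>z. transpose (g z))"
    by (intro continuous_on_transpose continuous_g)
  note mult = bounded_bilinear.bounded_uniform_limit[OF bounded_bilinear_matrix_vector_mult]
  have "uniform_limit K (\<lambda>s z. matrix_inv R *v (transpose (g z) *v D s z))
      (\<lambda>z. matrix_inv R *v (transpose (g z) *v E z)) sequentially"
    by (intro mult uniform_limit_const D bdd continuous_on_const
        bounded_bilinear.continuous_on[OF bounded_bilinear_matrix_vector_mult] gT E)
  then show ?thesis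
    unfolding greedy_def
    by (intro bounded_linear.uniform_limit[OF bounded_linear_scaleR_right])
qed

end

section \<open>Monotonicity and convergence of the policy iteration\<close>

theorem theorem4p5:
  fixes f :: "real^'n \<Rightarrow> real^'n"
    and g :: "real^'n \<Rightarrow> real^'m^'n"
    and h :: "real^'n \<Rightarrow> real"
    and R :: "real^'m^'m"
    and u0 :: "real^'n \<Rightarrow> real^'m"
    and v :: "nat \<Rightarrow> real^'n \<Rightarrow> real"
    and u :: "nat \<Rightarrow> real^'n \<Rightarrow> real^'m"
  assumes "data_assumption f g h R"
    and "(optimal_value f g h R \<longlongrightarrow> \<infinity>) at_infinity"
    and "admissible f g u0 UNIV"
    and "C_infinity u0"
    and "policy_iteration f g h R u0 v u"
  shows
    "(\<forall>s x. optimal_value f g h R x \<le> ereal (v (Suc s) x) \<and> v (Suc s) x \<le> v s x) \<and>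
     ((\<forall>K. compact K \<longrightarrow>
         (\<exists>Cg>0. \<exists>CH>0. \<forall>s. \<forall>x\<in>K. norm (grad (v s) x) \<le> Cg \<and>
            (\<exists>H. has_hessian (v s) H x \<and> spectral_norm H \<le> CH))) \<longrightarrow>
      (\<forall>ustar. optimal_controller f g h R ustar \<longrightarrow>
         C_diff 1 (\<lambda>x. real_of_ereal (optimal_value f g h R x)) \<and>
         (\<forall>K. compact K \<longrightarrow>
            (\<lambda>s. C1_norm K (\<lambda>x. v s x - real_of_ereal (optimal_value f g h R x))) \<longlonglongrightarrow> 0) \<and>
         (\<forall>K. compact K \<longrightarrow> (\<lambda>s. C0_norm K (\<lambda>x. u s x - ustar x)) \<longlonglongrightarrow> 0)))"
proof -
  interpret control_problem f g h R by unfold_locales (rule assms(1))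
  note rad = assms(2)
  have C1: "C_diff 1 (v s)" and v0: "v s 0 = 0"
    and eq: "(f x + g x *v u s x) \<bullet> grad (v s) x + running_cost x (u s x) = 0"
    and step: "u (Suc s) = greedy (grad (v s))" for s x
    using assms(5) unfolding policy_iteration_def running_cost_def greedy_def
    by (auto simp: add.assoc)
  have G: "GHJB (u s) (v s) (grad (v s))" for s
    unfolding GHJB_def using C_diff_1_D[OF C1] v0 eq by blast
  \<comment> \<open>The equations are given for every \<open>s\<close>; that every
    \<open>u s\<close> has convergent trajectories is what needs induction, starting from the
    admissibility of \<open>u0\<close>.\<close>
  have st: "stabilizing (u s)" for s
  proof (induction s)
    case 0
    have "u 0 = u0" using assms(5) unfolding policy_iteration_def by blast
    then show ?case
      using assms(3) unfolding stabilizing_def admissible_def by (metis UNIV_I tendsto_norm_zero_iff)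
  next
    case (Suc s)
    then show ?case unfolding step by (rule stabilizing_greedy[OF rad G])
  qed
  have ge: "optimal_value f g h R x \<le> ereal (v s x)" for s x
    by (rule optimal_value_le_GHJB[OF G st])
  have decr: "v (Suc s) x \<le> v s x" for s x
    using G[of "Suc s"] st[of "Suc s"] unfolding step by (intro GHJB_greedy_le[OF G])
  have nonneg: "0 \<le> v s x" for s x
    using order_trans[OF optimal_value_nonneg ge] by simp
  show ?thesis
  proof (intro conjI allI impI ge decr)
    fix ustar
    assume bounds: "\<forall>K. compact K \<longrightarrow>
         (\<exists>Cg>0. \<exists>CH>0. \<forall>s. \<forall>x\<in>K. norm (grad (v s) x) \<le> Cg \<and>
            (\<exists>H. has_hessian (v s) H x \<and> spectral_norm H \<le> CH))"
      and opt: "optimal_controller f g h R ustar"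
    define w where "w x = lim (\<lambda>s. v s x)" for x
    have lim: "(\<lambda>s. v s x) \<longlonglongrightarrow> w x" for x
    proof -
      have "decseq (\<lambda>s. v s x)" by (intro decseq_SucI decr)
      then have "convergent (\<lambda>s. v s x)"
        by (rule decseq_convergent[of _ 0]) (auto simp: nonneg convergent_def)
      then show ?thesis unfolding w_def by (rule convergent_LIMSEQ_iff[THEN iffD1])
    qed
    have grad_bound: "\<exists>B. \<forall>s. \<forall>x\<in>cball 0 r. norm (grad (v s) x) \<le> B" for r
      using bounds[rule_format, OF compact_cball[of 0 r]] by blast
    \<comment> \<open>The ball is convex, so the uniform bound on the Hessians is a common Lipschitz
      constant for the gradients.\<close>
    have grad_lip: "\<exists>L. \<forall>s. \<forall>x\<in>cball 0 r. \<forall>y\<in>cball 0 r.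
        norm (grad (v s) x - grad (v s) y) \<le> L * norm (x - y)" for r
    proof -
      obtain L where L: "\<And>s x. x \<in> cball 0 r \<Longrightarrow> \<exists>H. has_hessian (v s) H x \<and> spectral_norm H \<le> L"
        using bounds[rule_format, OF compact_cball[of 0 r]] by blast
      have "norm (grad (v s) x - grad (v s) y) \<le> L * norm (x - y)"
        if "x \<in> cball 0 r" "y \<in> cball 0 r" for s x y
      proof -
        have "\<forall>z\<in>cball 0 r. \<exists>H. has_hessian (v s) H z \<and> spectral_norm H \<le> L" using L by blast
        from bchoice[OF this] obtain H where H: "\<And>z. z \<in> cball 0 r \<Longrightarrow> has_hessian (v s) (H z) z"
            "\<And>z. z \<in> cball 0 r \<Longrightarrow> spectral_norm (H z) \<le> L"
          by blast
        show ?thesis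
          using convex_cball _ _ that
        proof (rule differentiable_bound)
          fix z assume z: "z \<in> cball (0 :: real^'n) r"
          show "(grad (v s) has_derivative (*v) (H z)) (at z within cball 0 r)"
            using H(1)[OF z] unfolding has_hessian_def by (rule has_derivative_at_withinI)
          show "onorm ((*v) (H z)) \<le> L"
            using H(2)[OF z] unfolding spectral_norm_def .
        qed
      qed
      then show ?thesis by blast
    qed
    obtain E where E: "\<And>z. GDERIV w z :> E z" "continuous_on UNIV E"
        "\<And>r. uniform_limit (cball 0 r) v w sequentially"
        "\<And>r. uniform_limit (cball 0 r) (\<lambda>s. grad (v s)) E sequentially"
      using C1_limit_of_equi_lipschitz_gradients[OF C_diff_1_D(1)[OF C1] grad_bound grad_lip lim]
      by blast
    have unif: "uniform_limit K v w sequentially" "uniform_limit K (\<lambda>s. grad (v s)) E sequentially"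
      if K: "compact K" for K
    proof -
      obtain r where "\<forall>x\<in>K. norm x \<le> r"
        using compact_imp_bounded[OF K] unfolding bounded_iff by blast
      then have "K \<subseteq> cball 0 r" by auto
      then show "uniform_limit K v w sequentially" "uniform_limit K (\<lambda>s. grad (v s)) E sequentially"
        using uniform_limit_on_subset E(3,4) by blast+
    qed
    \<comment> \<open>The index is shifted because \<open>u 0\<close> is prescribed and only
      \<open>u (Suc s)\<close> is greedy for a gradient; convergence is insensitive to the
      shift.\<close>
    have unif_u: "uniform_limit K (\<lambda>s. u (Suc s)) (greedy E) sequentially" if "compact K" for K
      unfolding step by (rule uniform_limit_greedy[OF unif(2)[OF that] E(2) that])
    \<comment> \<open>At index \<open>Suc s\<close> the linear equation pairs
      \<open>u (Suc s)\<close>, greedy for \<open>grad (v s)\<close>, with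
      \<open>grad (v (Suc s))\<close>. Both gradients tend to \<open>E\<close>, so in the limit the
      Hamilton-Jacobi-Bellman equation appears.\<close>
    have "(f z + g z *v greedy E z) \<bullet> E z + running_cost z (greedy E z) = 0" for z
    proof -
      have E_lim: "(\<lambda>s. grad (v (Suc s)) z) \<longlonglongrightarrow> E z"
        using tendsto_uniform_limitI[OF unif(2)[of "{z}"], of z] by (intro LIMSEQ_Suc) simp
      have u_lim: "(\<lambda>s. u (Suc s) z) \<longlonglongrightarrow> greedy E z"
        using tendsto_uniform_limitI[OF unif_u[of "{z}"], of z] by simp
      \<comment> \<open>Applied to both \<open>g z\<close> and \<open>R\<close>, hence stated for
        matrices with any number of rows.\<close>
      have mult: "(\<lambda>s. A *v u (Suc s) z) \<longlonglongrightarrow> A *v greedy E z" for A :: "real^'m^'k"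
        by (rule bounded_linear.tendsto[OF matrix_vector_mul_bounded_linear u_lim])
      have "(\<lambda>s. (f z + g z *v u (Suc s) z) \<bullet> grad (v (Suc s)) z + running_cost z (u (Suc s) z))
          \<longlonglongrightarrow> (f z + g z *v greedy E z) \<bullet> E z + running_cost z (greedy E z)"
        unfolding running_cost_def by (intro tendsto_intros E_lim u_lim mult)
      then show ?thesis unfolding eq by (simp add: LIMSEQ_const_iff)
    qed
    moreover have "w 0 = 0" using lim[of 0] by (simp add: v0 LIMSEQ_const_iff)
    ultimately have HJB: "GHJB (greedy E) w E" unfolding GHJB_def using E(1,2) by blast
    have "optimal_value f g h R x \<le> ereal (w x)" for x
      using ge by (intro tendsto_lowerbound[OF tendsto_ereal[OF lim]]) auto
    note verified = hjb_verification[OF rad HJB this opt]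
    have val: "(\<lambda>x. real_of_ereal (optimal_value f g h R x)) = w"
      by (simp add: verified(1))
    show "C_diff 1 (\<lambda>x. real_of_ereal (optimal_value f g h R x))"
      unfolding val by (rule C_diff_1_I[OF E(1,2)])
    fix K :: "(real^'n) set" assume K: "compact K"
    show "(\<lambda>s. C1_norm K (\<lambda>x. v s x - real_of_ereal (optimal_value f g h R x))) \<longlonglongrightarrow> 0"
      unfolding verified(1) real_of_ereal.simps
      by (rule C1_norm_tendsto_0[OF C_diff_1_D(1)[OF C1] E(1) unif[OF K]])
    have "(\<lambda>s. C0_norm K (\<lambda>x. u (Suc s) x - ustar x)) \<longlonglongrightarrow> 0"
      unfolding verified(2) by (rule C0_norm_tendsto_0[OF unif_u[OF K]])
    then show "(\<lambda>s. C0_norm K (\<lambda>x. u s x - ustar x)) \<longlonglongrightarrow> 0"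
      by (rule LIMSEQ_imp_Suc)
  qed
qed

end
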